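(* Consider the erasure queue-channel described in the context, with Poisson arrivals of rate $\lambda<1$, i.i.d. service times of mean $1$, input alphabet $\mathcal{X}$, and erasure probability function $p:[0,\infty)\to[0,1]$: the $j$th symbol is unaffected with probability $1-p(W_j)$ and is erased with probability $p(W_j)$. Then its capacity is $$\lambda\,\log|\mathcal{X}|\;\mathbf{E}_{\pi}[1-p(W)]\quad\text{bits/sec},$$ where $\pi$ is the limiting distribution of $\{W_j\}$, irrespective of the receiver's knowledge of the arrival and the departure times of the symbols.
   Context: Queue. Symbols (qubits) $j=1,2,\dots$ are sent sequentially to a single-server FIFO queue (an M/GI/1 queue). Interarrival times are i.i.d. exponential with parameter $\lambda$; service times $S_j$ are i.i.d. with cumulative distribution $F_S$ and mean $1$ (service rate $\mu=1$); $\lambda<1$ for stability. $A_j$ and $D_j$ are the times when the $j$th symbol arrives at the queue and departs from the queue, respectively, and $W_j=D_j-A_j$ is the time that the $j$th symbol spends in the queue. $\{W_j\}$ is a Markov process with a unique limiting distribution $\pi$, and $\mathbf{E}_\pi$ is expectation with $W\sim\pi$. Channel. The input symbols $X_j$ take values in $\mathcal{X}$, of cardinality $|\mathcal{X}|$. No information is encoded in the timings, so the inputs are independent of the arrival and departure times. For an $n$-length transmission the channel law is $\prod_{j=1}^n\mathbf{P}(Y_j\mid X_j,W_j)$, where $Y_j=X_j$ with probability $1-p(W_j)$ and $Y_j$ is an erasure symbol (not in $\mathcal{X}$) with probability $p(W_j)$; the outputs depend on the arrival and departure times only through the $W_j$. Logs are base 2. Capacity. Let $M,\hat M\in\mathcal{M}$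 be the transmitted and decoded messages. An $(n,\tilde R,T)$ code consists of an encoding function $X^n=f(M)$ and a decoding function $\hat M=g(Y^n,A^n,D^n)$ (a function of $Y^n$ only, if the receiver does not know the arrival and departure times), where $Z^n=(Z_1,\dots,Z_n)$, $|\mathcal{M}|=2^{n\tilde R}$ and, for each codeword, the expected total time for all the symbols to reach the receiver is less than $T$. The code is $\epsilon$-achievable if the decoder chooses $\hat M$ with average probability of error less than $\epsilon$. If for any $0<\epsilon<1$ there exists an $\epsilon$-achievable $(n,\tilde R,T)$ code, the rate $R=n\tilde R/T$ is said to be achievable. The capacity is the supremum of all achievable rates for the given arrival process. The transmitter knows the statistics of the arrival process, but not its realization before encoding.
   Formalization: A rate is taken to be achievable only if, for every ε, ε-achievable codes of that rate exist with arbitrarily large n; with n unrestricted and an initially empty queue, one-symbol codes can exceed the claimed capacity. *)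

theory Defs
  imports "HOL-Probability.Probability"
begin

text \<open>
  Symbols are numbered \<open>1, 2, \<dots>\<close> as usual: \<open>\<tau> j\<close> is the time between the arrivals of symbols
  \<open>j - 1\<close> and \<open>j\<close> (for \<open>j = 1\<close>, the time of the first arrival), and \<open>S j\<close> is the service time of
  symbol \<open>j\<close>.  The values \<open>\<tau> 0\<close> and \<open>S 0\<close> play no role.  The server starts idle at time 0.
\<close>

definition arrival_time :: "(nat \<Rightarrow> 'w \<Rightarrow> real) \<Rightarrow> nat \<Rightarrow> 'w \<Rightarrow> real" where
  "arrival_time \<tau> j \<omega> = (\<Sum>i=1..j. \<tau> i \<omega>)"

primrec departure_time ::
  "(nat \<Rightarrow> 'w \<Rightarrow> real) \<Rightarrow> (nat \<Rightarrow> 'w \<Rightarrow> real) \<Rightarrow> nat \<Rightarrow> 'w \<Rightarrow> real" where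
  "departure_time \<tau> S 0 \<omega> = 0"
| "departure_time \<tau> S (Suc j) \<omega> =
     max (departure_time \<tau> S j \<omega>) (arrival_time \<tau> (Suc j) \<omega>) + S (Suc j) \<omega>"

definition sojourn_time ::
  "(nat \<Rightarrow> 'w \<Rightarrow> real) \<Rightarrow> (nat \<Rightarrow> 'w \<Rightarrow> real) \<Rightarrow> nat \<Rightarrow> 'w \<Rightarrow> real" where
  "sojourn_time \<tau> S j \<omega> = departure_time \<tau> S j \<omega> - arrival_time \<tau> j \<omega>"

text \<open>The hypothesis \<open>F = cdf \<dots>\<close> makes the service times identically distributed.\<close>

locale mgi1_queue = prob_space Q for Q :: "'w measure" +
  fixes \<tau> S :: "nat \<Rightarrow> 'w \<Rightarrow> real" and lam :: real and F :: "real \<Rightarrow> real"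
  assumes lam_pos: "0 < lam"
    and lam_less_1: "lam < 1"
    and independent: "indep_vars (\<lambda>_. borel) (case_sum \<tau> S) ({1..} <+> {1..})"
    and interarrival: "j \<ge> 1 \<Longrightarrow> distributed Q lborel (\<tau> j) (exponential_density lam)"
    and service_cdf: "j \<ge> 1 \<Longrightarrow> cdf (distr Q borel (S j)) = F"
    and service_nonneg: "j \<ge> 1 \<Longrightarrow> AE \<omega> in Q. 0 \<le> S j \<omega>"
    and service_integrable: "j \<ge> 1 \<Longrightarrow> integrable Q (S j)"
    and service_mean: "j \<ge> 1 \<Longrightarrow> expectation (S j) = 1"

definition limiting_distribution ::
  "'w measure \<Rightarrow> (nat \<Rightarrow> 'w \<Rightarrow> real) \<Rightarrow> real measure \<Rightarrow> bool" where
  "limiting_distribution Q W \<pi> \<longleftrightarrow>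
     real_distribution \<pi> \<and> weak_conv_m (\<lambda>j. distr Q borel (W j)) \<pi>"

text \<open>
  The output alphabet is \<open>'x option\<close>, with \<open>None\<close> for the erasure.  Words of length \<open>n\<close> are
  functions on \<open>{1..n}\<close> with the value \<^const>\<open>undefined\<close> elsewhere.
\<close>

definition erasure_channel :: "(real \<Rightarrow> real) \<Rightarrow> 'x \<Rightarrow> real \<Rightarrow> 'x option pmf" where
  "erasure_channel p x w = map_pmf (\<lambda>erased. if erased then None else Some x) (bernoulli_pmf (p w))"

definition channel_word ::
  "(real \<Rightarrow> real) \<Rightarrow> nat \<Rightarrow> (nat \<Rightarrow> 'x) \<Rightarrow> (nat \<Rightarrow> real) \<Rightarrow> (nat \<Rightarrow> 'x option) pmf" where
  "channel_word p n x w = Pi_pmf {1..n} undefined (\<lambda>j. erasure_channel p (x j) (w j))"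

text \<open>
  Messages are the numbers below \<open>m\<close>.  A decoder receives the output word and the words of
  arrival and departure times; a receiver that does not know the times must ignore the latter two.
\<close>

definition encoder :: "'x set \<Rightarrow> nat \<Rightarrow> nat \<Rightarrow> (nat \<Rightarrow> nat \<Rightarrow> 'x) \<Rightarrow> bool" where
  "encoder X n m f \<longleftrightarrow> (\<forall>i<m. f i \<in> {1..n} \<rightarrow>\<^sub>E X)"

definition decoder ::
  "bool \<Rightarrow> nat \<Rightarrow> nat \<Rightarrow>
   ((nat \<Rightarrow> 'x option) \<Rightarrow> (nat \<Rightarrow> real) \<Rightarrow> (nat \<Rightarrow> real) \<Rightarrow> nat) \<Rightarrow> bool" where
  "decoder times_known n m g \<longleftrightarrow>
     (\<forall>y a d. g y a d < m) \<and>
     (if times_known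
      then \<forall>y. (\<lambda>(a, d). g y a d) \<in>
             (\<Pi>\<^sub>M j\<in>{1..n}. borel) \<Otimes>\<^sub>M (\<Pi>\<^sub>M j\<in>{1..n}. borel) \<rightarrow>\<^sub>M count_space {..<m}
      else \<exists>h. \<forall>y a d. g y a d = h y)"

text \<open>
  The message is uniform and independent of the queue, and given the message and the queue the
  output word has law \<^const>\<open>channel_word\<close>.
\<close>

definition error_probability ::
  "'w measure \<Rightarrow> (nat \<Rightarrow> 'w \<Rightarrow> real) \<Rightarrow> (nat \<Rightarrow> 'w \<Rightarrow> real) \<Rightarrow> (real \<Rightarrow> real) \<Rightarrow> nat \<Rightarrow> nat \<Rightarrow>
   (nat \<Rightarrow> nat \<Rightarrow> 'x) \<Rightarrow> ((nat \<Rightarrow> 'x option) \<Rightarrow> (nat \<Rightarrow> real) \<Rightarrow> (nat \<Rightarrow> real) \<Rightarrow> nat) \<Rightarrow> real" where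
  "error_probability Q \<tau> S p n m f g =
     (\<Sum>i<m. \<integral>\<omega>. measure_pmf.prob (channel_word p n (f i) (\<lambda>j. sojourn_time \<tau> S j \<omega>))
        {y. g y (\<lambda>j\<in>{1..n}. arrival_time \<tau> j \<omega>) (\<lambda>j\<in>{1..n}. departure_time \<tau> S j \<omega>) \<noteq> i} \<partial>Q)
     / real m"

text \<open>
  All symbols have reached the receiver at time \<open>D\<^sub>n\<close>, whichever codeword is sent.
\<close>

definition eps_achievable_code ::
  "'w measure \<Rightarrow> (nat \<Rightarrow> 'w \<Rightarrow> real) \<Rightarrow> (nat \<Rightarrow> 'w \<Rightarrow> real) \<Rightarrow> 'x set \<Rightarrow> (real \<Rightarrow> real) \<Rightarrow> bool \<Rightarrow>
   real \<Rightarrow> nat \<Rightarrow> real \<Rightarrow> real \<Rightarrow> bool" where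
  "eps_achievable_code Q \<tau> S X p times_known \<epsilon> n Rt T \<longleftrightarrow>
     (\<exists>m f g. real m = 2 powr (real n * Rt) \<and> encoder X n m f \<and> decoder times_known n m g \<and>
        (\<integral>\<omega>. departure_time \<tau> S n \<omega> \<partial>Q) < T \<and>
        error_probability Q \<tau> S p n m f g < \<epsilon>)"

text \<open>
  The codes witnessing achievability must have unbounded blocklength.  With a fixed blocklength
  the initially empty queue could be exploited: if \<open>card X \<ge> 2\<close>, \<open>S = 1\<close> always, \<open>p w = 0\<close> for \<open>w \<le> 1\<close> and
  \<open>p w = 1\<close> for \<open>w > 1\<close>, then one symbol sent alone arrives without error, at a rate arbitrarily
  close to \<open>lam / (1 + lam) * log 2 (card X)\<close>, which exceeds the long-run value
  \<open>lam * (1 - lam) * log 2 (card X)\<close>.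
\<close>

definition achievable_rate ::
  "'w measure \<Rightarrow> (nat \<Rightarrow> 'w \<Rightarrow> real) \<Rightarrow> (nat \<Rightarrow> 'w \<Rightarrow> real) \<Rightarrow> 'x set \<Rightarrow> (real \<Rightarrow> real) \<Rightarrow> bool \<Rightarrow>
   real \<Rightarrow> bool" where
  "achievable_rate Q \<tau> S X p times_known R \<longleftrightarrow>
     (\<forall>\<epsilon>. 0 < \<epsilon> \<and> \<epsilon> < 1 \<longrightarrow>
        (\<forall>N\<ge>1. \<exists>n\<ge>N. \<exists>Rt T. eps_achievable_code Q \<tau> S X p times_known \<epsilon> n Rt T \<and> R = real n * Rt / T))"

definition queue_channel_capacity ::
  "'w measure \<Rightarrow> (nat \<Rightarrow> 'w \<Rightarrow> real) \<Rightarrow> (nat \<Rightarrow> 'w \<Rightarrow> real) \<Rightarrow> 'x set \<Rightarrow> (real \<Rightarrow> real) \<Rightarrow> bool \<Rightarrow>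
   ereal" where
  "queue_channel_capacity Q \<tau> S X p times_known =
     (SUP R\<in>{R. achievable_rate Q \<tau> S X p times_known R}. ereal R)"

end

theory Submission
  imports Defs
begin

text \<open>
  By the Lindley recursion, the queue restarted empty at time \<open>i\<close> merges with the true one unless
  \<open>W i\<close> dominates the subsequent drift \<open>\<tau> - S\<close>.  That drift tends to infinity in probability and
  the \<open>W i\<close> are tight because they converge weakly, so the merging time is tight uniformly in \<open>i\<close>.
  Hence the laws of the \<open>W j\<close> are Cauchy in total variation (so their weak limit \<open>\<pi>\<close> is a limit
  in total variation, and merely measurable \<open>p\<close> are allowed) and \<open>W i\<close> and \<open>W j\<close> decorrelate as
  \<open>j - i\<close> grows, which gives \<open>(1/n) (h (W 1) + \<dots> + h (W n)) \<longrightarrow> \<integral>h d\<pi>\<close> in \<open>L\<^sup>1\<close> for bounded measurable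
  \<open>h\<close>.

  For the channel, condition on the erasure pattern.  If \<open>K\<close> of the symbols arrive, at most
  \<open>min m (|X| ^ K)\<close> of the \<open>m\<close> messages are decoded correctly, whatever the decoder knows about the
  times; averaging gives the converse.  Conversely, uniformly random codewords decoded by
  consistency with the received symbols fail with probability at most \<open>min 1 (m |X| ^ (-K))\<close>, which
  is bounded by \<open>(m |X| ^ (-K)) powr s\<close> with a small \<open>s > 0\<close>; the expectation of the latter over
  the pattern factorizes.  Finally \<open>E D\<^sub>n = n / lam + E W\<^sub>n\<close> with \<open>E W\<^sub>n = o(n)\<close>.
\<close>

section \<open>A weak law of large numbers\<close>

text \<open>The hypotheses give only weak convergence to \<open>\<pi>\<close>, while
  \<open>p\<close> may be discontinuous and the service times may have infinite variance. Hence
  tightness is drawn from weak convergence, and truncation replaces second moments in the weak law.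
  Convergence in \<open>L^1\<close> serves both directions: it yields the mean survival fraction for
  the converse and, by Markov's inequality, its concentration for random coding. In the converse,
  min m (|X| ^ K) is not concave in K, so Jensen's inequality cannot replace K by its mean. A
  majorant affine in K does; it costs one additional bit, which vanishes per symbol. In random
  coding, the expectation of the plain union bound m |X| ^ (-K) is dominated by rare patterns with
  few received symbols, and in general falls short of capacity. The exponent s cures this: (1 - |X|
  ^ (-s)) / s tends to ln |X| as s tends to 0, so the admissible rates approach the mean survival
  fraction times ln |X|, in nats per symbol.\<close>

lemma Cesaro_tendsto_0:
  fixes a :: "nat \<Rightarrow> real"
  assumes lim: "a \<longlonglongrightarrow> 0"
  shows "(\<lambda>n. (\<Sum>d<n. a d) / real n) \<longlonglongrightarrow> 0"
proof (rule LIMSEQ_I)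
  fix \<epsilon> :: real assume \<epsilon>: "0 < \<epsilon>"
  obtain N where N: "\<And>d. d \<ge> N \<Longrightarrow> \<bar>a d\<bar> < \<epsilon> / 2"
    using LIMSEQ_D[OF lim, of "\<epsilon> / 2"] \<epsilon> by auto
  define C where "C = (\<Sum>d<N. \<bar>a d\<bar>)"
  have C: "0 \<le> C" by (simp add: C_def sum_nonneg)
  obtain n0 :: nat where n0: "2 * C / \<epsilon> < real n0" using reals_Archimedean2 by blast
  have "norm ((\<Sum>d<n. a d) / real n - 0) < \<epsilon>" if n: "n \<ge> max n0 (Suc N)" for n
  proof -
    have pos: "0 < real n" using n by simp
    have split: "{..<n} = {..<N} \<union> {N..<n}" using n by auto
    have "\<bar>\<Sum>d<n. a d\<bar> \<le> (\<Sum>d<n. \<bar>a d\<bar>)" by (rule sum_abs)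
    also have "\<dots> = C + (\<Sum>d=N..<n. \<bar>a d\<bar>)"
      unfolding C_def split by (rule sum.union_disjoint) auto
    also have "(\<Sum>d=N..<n. \<bar>a d\<bar>) \<le> (\<Sum>d=N..<n. \<epsilon> / 2)"
      using N by (intro sum_mono) (auto intro: less_imp_le)
    also have "(\<Sum>d=N..<n. \<epsilon> / 2) \<le> real n * (\<epsilon> / 2)"
      using \<epsilon> by (simp add: field_simps)
    finally have "\<bar>\<Sum>d<n. a d\<bar> \<le> C + real n * (\<epsilon> / 2)" by simp
    moreover have "C < real n * (\<epsilon> / 2)"
      using n0 n \<epsilon> by (simp add: field_simps) (smt (verit) mult_left_mono of_nat_mono)
    ultimately show ?thesis using pos by (simp add: field_simps)
  qed
  then show "\<exists>no. \<forall>n\<ge>no. norm ((\<Sum>d<n. a d) / real n - 0) < \<epsilon>" by blast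
qed

context prob_space
begin

text \<open>Passes from second moments to \<open>L^1\<close> without square roots: where
  \<open>\<bar>X x\<bar>\<close> exceeds \<delta>, it is at most
  \<open>(X x)\<^sup>2 / \<delta>\<close>. The free \<delta> is later balanced against the second
  moment.\<close>

lemma expectation_abs_le:
  fixes X :: "'a \<Rightarrow> real"
  assumes [measurable]: "random_variable borel X"
    and bnd: "\<And>x. \<bar>X x\<bar> \<le> B" and \<delta>: "0 < \<delta>"
  shows "expectation (\<lambda>x. \<bar>X x\<bar>) \<le> \<delta> + expectation (\<lambda>x. (X x)\<^sup>2) / \<delta>"
proof -
  have i: "integrable M (\<lambda>x. \<bar>X x\<bar>)"
    using bnd by (intro integrable_const_bound[where B=B]) auto
  have i2: "integrable M (\<lambda>x. (X x)\<^sup>2)"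
    using bnd by (intro integrable_const_bound[where B="B\<^sup>2"])
      (auto simp: abs_le_square_iff[symmetric] intro!: AE_I2 order_trans[OF bnd])
  have "\<bar>X x\<bar> \<le> \<delta> + (X x)\<^sup>2 / \<delta>" for x
  proof (cases "\<bar>X x\<bar> \<le> \<delta>")
    case False
    then have "\<bar>X x\<bar> * \<delta> \<le> \<bar>X x\<bar> * \<bar>X x\<bar>" by (intro mult_left_mono) auto
    then have "\<bar>X x\<bar> \<le> (X x)\<^sup>2 / \<delta>"
      using \<delta> by (simp add: pos_le_divide_eq power2_eq_square)
    then show ?thesis using \<delta> by simp
  qed (use \<delta> in \<open>simp add: add_increasing2\<close>)
  then have "expectation (\<lambda>x. \<bar>X x\<bar>) \<le> expectation (\<lambda>x. \<delta> + (X x)\<^sup>2 / \<delta>)"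
    using i i2 by (intro integral_mono) auto
  also have "\<dots> = \<delta> + expectation (\<lambda>x. (X x)\<^sup>2) / \<delta>"
    using i2 by (simp add: prob_space)
  finally show ?thesis .
qed

text \<open>The second moment of the average is a mean over pairs of
  \<open>expectation (\<lambda>x. k i x * k j x)\<close>, hence at most twice a Cesaro mean of
  bounds that depend only on the distance. It serves both the truncated variables of the weak law,
  with \<rho> = 0, and the weakly dependent sojourn times.\<close>

lemma average_tendsto_0_L1:
  fixes k :: "nat \<Rightarrow> 'a \<Rightarrow> real" and \<rho> :: "nat \<Rightarrow> real"
  assumes rv[measurable]: "\<And>i. 1 \<le> i \<Longrightarrow> random_variable borel (k i)"
    and bnd: "\<And>i x. 1 \<le> i \<Longrightarrow> \<bar>k i x\<bar> \<le> B"
    and cov: "\<And>i j. 1 \<le> i \<Longrightarrow> i < j \<Longrightarrow> \<bar>expectation (\<lambda>x. k i x * k j x)\<bar> \<le> \<rho> (j - i)"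
    and lim: "\<rho> \<longlonglongrightarrow> 0"
  shows "(\<lambda>n. expectation (\<lambda>x. \<bar>(\<Sum>i=1..n. k i x) / real n\<bar>)) \<longlonglongrightarrow> 0"
proof -
  have B: "0 \<le> B" using bnd[of 1 undefined] by simp
  \<comment> \<open>\<open>cov\<close> is silent at distance 0, so the diagonal gets the trivial
    bound. The absolute value makes \<open>r\<close> nonnegative, so that its sums grow with their
    index set.\<close>
  define r where "r d = (if d = 0 then B\<^sup>2 else \<bar>\<rho> d\<bar>)" for d
  have r_nonneg: "0 \<le> r d" for d by (simp add: r_def)
  have "r \<longlonglongrightarrow> 0"
  proof (rule Lim_transform_eventually)
    show "(\<lambda>d. \<bar>\<rho> d\<bar>) \<longlonglongrightarrow> 0" using lim by (rule tendsto_rabs_zero)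
    show "\<forall>\<^sub>F d in sequentially. \<bar>\<rho> d\<bar> = r d"
      using eventually_gt_at_top[of 0] by eventually_elim (simp add: r_def)
  qed
  then have ces: "(\<lambda>n. (\<Sum>d<n. r d) / real n) \<longlonglongrightarrow> 0" by (rule Cesaro_tendsto_0)
  have ij: "integrable M (\<lambda>x. k i x * k j x)" if "1 \<le> i" "1 \<le> j" for i j
    using that bnd
    by (intro integrable_const_bound[where B="B * B"]) (auto simp: abs_mult intro!: mult_mono B)
  have cov': "expectation (\<lambda>x. k i x * k j x) \<le> r (nat \<bar>int i - int j\<bar>)" if ge: "1 \<le> i" "1 \<le> j" for i j
  proof -
    consider "i = j" | "i < j" | "j < i" by linarith
    then show ?thesis
    proof cases
      case 1
      have "(k i x)\<^sup>2 \<le> B\<^sup>2" for x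
        using bnd[OF ge(1)] B by (subst abs_le_square_iff[symmetric]) simp
      then have "expectation (\<lambda>x. k i x * k i x) \<le> expectation (\<lambda>x. B\<^sup>2)"
        using ij[of i i] ge by (intro integral_mono) (simp_all add: power2_eq_square)
      then show ?thesis using 1 by (simp add: r_def prob_space)
    next
      case 2
      then have "nat \<bar>int i - int j\<bar> = j - i" by auto
      then show ?thesis using cov[of i j] ge 2 by (simp add: r_def)
    next
      case 3
      then have "nat \<bar>int i - int j\<bar> = i - j" by auto
      then show ?thesis using cov[of j i] ge 3 by (simp add: r_def mult.commute)
    qed
  qed
  \<comment> \<open>On either side of the diagonal the distances are distinct and below
    \<open>n\<close>; counting the diagonal on both sides is harmless.\<close>
  have row: "(\<Sum>j=1..n. r (nat \<bar>int i - int j\<bar>)) \<le> 2 * (\<Sum>d<n. r d)" if i: "i \<in> {1..n}" for i n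
  proof -
    have "(\<Sum>j=1..n. r (nat \<bar>int i - int j\<bar>)) \<le>
        (\<Sum>j=1..i. r (nat \<bar>int i - int j\<bar>)) + (\<Sum>j=i..n. r (nat \<bar>int i - int j\<bar>))"
    proof -
      have split: "{1..n} = {1..i} \<union> {i<..n}" using i by auto
      have "(\<Sum>j=1..n. r (nat \<bar>int i - int j\<bar>)) =
          (\<Sum>j=1..i. r (nat \<bar>int i - int j\<bar>)) + (\<Sum>j\<in>{i<..n}. r (nat \<bar>int i - int j\<bar>))"
        unfolding split by (rule sum.union_disjoint) auto
      also have "(\<Sum>j\<in>{i<..n}. r (nat \<bar>int i - int j\<bar>)) \<le> (\<Sum>j=i..n. r (nat \<bar>int i - int j\<bar>))"
        by (intro sum_mono2) (auto simp: r_nonneg)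
      finally show ?thesis by simp
    qed
    also have "(\<Sum>j=1..i. r (nat \<bar>int i - int j\<bar>)) = (\<Sum>d\<in>(\<lambda>j. i - j) ` {1..i}. r d)"
      by (subst sum.reindex) (auto intro!: inj_onI sum.cong arg_cong[where f=r])
    also have "\<dots> \<le> (\<Sum>d<n. r d)" using i by (intro sum_mono2) (auto simp: r_nonneg)
    also have "(\<Sum>j=i..n. r (nat \<bar>int i - int j\<bar>)) = (\<Sum>d\<in>(\<lambda>j. j - i) ` {i..n}. r d)"
      by (subst sum.reindex) (auto intro!: inj_onI sum.cong arg_cong[where f=r])
    also have "\<dots> \<le> (\<Sum>d<n. r d)" using i by (intro sum_mono2) (auto simp: r_nonneg)
    finally show ?thesis by simp
  qed
  have second: "expectation (\<lambda>x. ((\<Sum>i=1..n. k i x) / real n)\<^sup>2) \<le> 2 * ((\<Sum>d<n. r d) / real n)" for n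
  proof -
    have inner: "integrable M (\<lambda>x. \<Sum>j=1..n. k i x * k j x)" if "1 \<le> i" for i
      using that by (intro Bochner_Integration.integrable_sum ij) auto
    have "expectation (\<lambda>x. \<Sum>i=1..n. \<Sum>j=1..n. k i x * k j x)
        = (\<Sum>i=1..n. expectation (\<lambda>x. \<Sum>j=1..n. k i x * k j x))"
      by (intro Bochner_Integration.integral_sum inner) auto
    also have "\<dots> = (\<Sum>i=1..n. \<Sum>j=1..n. expectation (\<lambda>x. k i x * k j x))"
      by (intro sum.cong refl Bochner_Integration.integral_sum ij) auto
    finally have expand: "expectation (\<lambda>x. \<Sum>i=1..n. \<Sum>j=1..n. k i x * k j x)
        = (\<Sum>i=1..n. \<Sum>j=1..n. expectation (\<lambda>x. k i x * k j x))" .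
    have "expectation (\<lambda>x. ((\<Sum>i=1..n. k i x) / real n)\<^sup>2)
        = expectation (\<lambda>x. (\<Sum>i=1..n. \<Sum>j=1..n. k i x * k j x) / (real n)\<^sup>2)"
      by (simp add: power_divide power2_eq_square sum_product)
    also have "\<dots> = (\<Sum>i=1..n. \<Sum>j=1..n. expectation (\<lambda>x. k i x * k j x)) / (real n)\<^sup>2"
      by (simp only: integral_divide_zero expand)
    also have "\<dots> \<le> (\<Sum>i=1..n. \<Sum>j=1..n. r (nat \<bar>int i - int j\<bar>)) / (real n)\<^sup>2"
      using cov' by (intro divide_right_mono sum_mono) auto
    also have "\<dots> \<le> (\<Sum>i=1..n. 2 * (\<Sum>d<n. r d)) / (real n)\<^sup>2"
      using row by (intro divide_right_mono sum_mono) auto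
    also have "\<dots> = 2 * ((\<Sum>d<n. r d) / real n)" by (simp add: power2_eq_square)
    finally show ?thesis .
  qed
  have avg_bnd: "\<bar>(\<Sum>i=1..n. k i x) / real n\<bar> \<le> B" for n x
  proof -
    have "\<bar>\<Sum>i=1..n. k i x\<bar> \<le> (\<Sum>i=1..n. \<bar>k i x\<bar>)" by (rule sum_abs)
    also have "\<dots> \<le> (\<Sum>i=1..n. B)" using bnd by (intro sum_mono) auto
    finally show ?thesis using B by (cases "n = 0") (auto simp: field_simps)
  qed
  show ?thesis
  proof (rule LIMSEQ_I)
    fix \<epsilon> :: real assume \<epsilon>: "0 < \<epsilon>"
    \<comment> \<open>The bound \<open>second\<close> doubles \<epsilon>^2 / 8, and division by
      \<epsilon> / 2 then leaves the missing \<epsilon> / 2.\<close>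
    then obtain N where N: "\<And>n. n \<ge> N \<Longrightarrow> \<bar>(\<Sum>d<n. r d) / real n\<bar> < \<epsilon>\<^sup>2 / 8"
      using LIMSEQ_D[OF ces, of "\<epsilon>\<^sup>2 / 8"] by auto
    have "norm (expectation (\<lambda>x. \<bar>(\<Sum>i=1..n. k i x) / real n\<bar>) - 0) < \<epsilon>" if "n \<ge> N" for n
    proof -
      have "expectation (\<lambda>x. \<bar>(\<Sum>i=1..n. k i x) / real n\<bar>)
          \<le> \<epsilon> / 2 + expectation (\<lambda>x. ((\<Sum>i=1..n. k i x) / real n)\<^sup>2) / (\<epsilon> / 2)"
        using avg_bnd \<epsilon> by (intro expectation_abs_le[where B=B]) auto
      also have "\<dots> < \<epsilon> / 2 + (\<epsilon>\<^sup>2 / 4) / (\<epsilon> / 2)"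
        using second[of n] N[OF that] \<epsilon>
        by (intro add_strict_left_mono divide_strict_right_mono) linarith+
      also have "\<dots> = \<epsilon>" using \<epsilon> by (simp add: power2_eq_square)
      finally show ?thesis by (simp add: Bochner_Integration.integral_nonneg)
    qed
    then show "\<exists>no. \<forall>n\<ge>no. norm (expectation (\<lambda>x. \<bar>(\<Sum>i=1..n. k i x) / real n\<bar>) - 0) < \<epsilon>" by blast
  qed
qed

text \<open>With only a first moment available, the second-moment argument is applied to the values
  clamped to \<open>[-b, b]\<close>. The clamping error has mean \<open>\<delta> b\<close> for every
  index, as the laws agree, and it vanishes for large \<open>b\<close> by dominated convergence.
  Pairwise independence is the natural hypothesis, since only products of two variables
  occur.\<close>

theorem weak_law_of_large_numbers_L1:
  fixes Z :: "nat \<Rightarrow> 'a \<Rightarrow> real"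
  assumes indep: "\<And>i j. 1 \<le> i \<Longrightarrow> i < j \<Longrightarrow> indep_var borel (Z i) borel (Z j)"
    and ident: "\<And>i. 1 \<le> i \<Longrightarrow> distr M borel (Z i) = distr M borel (Z 1)"
    and int: "integrable M (Z 1)"
  shows "(\<lambda>n. expectation (\<lambda>x. \<bar>(\<Sum>i=1..n. Z i x) / real n - expectation (Z 1)\<bar>)) \<longlonglongrightarrow> 0"
proof -
  have rv[measurable]: "random_variable borel (Z i)" if "1 \<le> i" for i
    using indep_var_rv1[OF indep[OF that lessI]] .
  have transfer: "expectation (\<lambda>x. f (Z i x)) = expectation (\<lambda>x. f (Z 1 x))"
    if i: "1 \<le> i" and f: "f \<in> borel_measurable borel" for i and f :: "real \<Rightarrow> real"
    using integral_distr[OF rv[OF i] f] integral_distr[OF rv[of 1] f] ident[OF i] by simp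
  have transfer_int: "integrable M (\<lambda>x. f (Z i x)) \<longleftrightarrow> integrable M (\<lambda>x. f (Z 1 x))"
    if i: "1 \<le> i" and f: "f \<in> borel_measurable borel" for i and f :: "real \<Rightarrow> real"
    using integrable_distr_eq[OF rv[OF i] f] integrable_distr_eq[OF rv[of 1] f] ident[OF i] by simp
  define cut :: "nat \<Rightarrow> real \<Rightarrow> real" where "cut b z = max (- real b) (min z (real b))" for b z
  have cut_bnd: "\<bar>cut b z\<bar> \<le> real b" for b z by (auto simp: cut_def)
  have cut_diff: "\<bar>z - cut b z\<bar> \<le> \<bar>z\<bar>" for b z by (auto simp: cut_def)
  have cut_meas[measurable]: "cut b \<in> borel_measurable borel" for b unfolding cut_def by measurable
  define \<delta> where "\<delta> b = expectation (\<lambda>x. \<bar>Z 1 x - cut b (Z 1 x)\<bar>)" for b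
  have \<delta>: "\<delta> \<longlonglongrightarrow> 0"
  proof -
    have "(\<lambda>b. expectation (\<lambda>x. \<bar>Z 1 x - cut b (Z 1 x)\<bar>)) \<longlonglongrightarrow> expectation (\<lambda>x. 0)"
    proof (rule integral_dominated_convergence[where w="\<lambda>x. \<bar>Z 1 x\<bar>"])
      show "AE x in M. (\<lambda>b. \<bar>Z 1 x - cut b (Z 1 x)\<bar>) \<longlonglongrightarrow> 0"
      proof (rule AE_I2)
        fix x
        obtain n :: nat where n: "\<bar>Z 1 x\<bar> \<le> real n" using real_arch_simple by blast
        have "\<forall>\<^sub>F b in sequentially. \<bar>Z 1 x - cut b (Z 1 x)\<bar> = 0"
          using eventually_ge_at_top[of n]
        proof eventually_elim
          case (elim b)
          then have "\<bar>Z 1 x\<bar> \<le> real b" using n by linarith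
          then show ?case by (auto simp: cut_def)
        qed
        then show "(\<lambda>b. \<bar>Z 1 x - cut b (Z 1 x)\<bar>) \<longlonglongrightarrow> 0" by (rule tendsto_eventually)
      qed
    qed (use int cut_diff in auto)
    then show ?thesis by (simp add: \<delta>_def[abs_def])
  qed
  show ?thesis
  proof (rule LIMSEQ_I)
    fix \<epsilon> :: real assume \<epsilon>: "0 < \<epsilon>"
    obtain b where b: "\<delta> b < \<epsilon> / 3"
    proof -
      obtain N where "\<And>b. b \<ge> N \<Longrightarrow> norm (\<delta> b - 0) < \<epsilon> / 3"
        using LIMSEQ_D[OF \<delta>, of "\<epsilon> / 3"] \<epsilon> by auto
      from this[of N] show ?thesis by (intro that[of N]) auto
    qed
    define e where "e = expectation (\<lambda>x. cut b (Z 1 x))"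
    have int_cut: "integrable M (\<lambda>x. cut b (Z i x))" if "1 \<le> i" for i
      using cut_bnd that by (intro integrable_const_bound[where B="real b"]) auto
    have "(\<lambda>n. expectation (\<lambda>x. \<bar>(\<Sum>i=1..n. (cut b (Z i x) - e)) / real n\<bar>)) \<longlonglongrightarrow> 0"
    proof (rule average_tendsto_0_L1[where B="real b + \<bar>e\<bar>" and \<rho>="\<lambda>_. 0"])
      fix i j :: nat assume ij: "1 \<le> i" "i < j"
      have "indep_var borel ((\<lambda>z. cut b z - e) \<circ> Z i) borel ((\<lambda>z. cut b z - e) \<circ> Z j)"
        using indep[OF ij] by (rule indep_var_compose) auto
      then have "expectation (\<lambda>x. (cut b (Z i x) - e) * (cut b (Z j x) - e))
          = expectation (\<lambda>x. cut b (Z i x) - e) * expectation (\<lambda>x. cut b (Z j x) - e)"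
        using indep_var_lebesgue_integral[of "\<lambda>x. cut b (Z i x) - e" "\<lambda>x. cut b (Z j x) - e"]
          int_cut[of i] int_cut[of j] ij by (simp add: comp_def)
      also have "expectation (\<lambda>x. cut b (Z i x) - e) = 0"
        using transfer[OF ij(1), of "cut b"] int_cut[OF ij(1)] by (simp add: e_def prob_space)
      finally show "\<bar>expectation (\<lambda>x. (cut b (Z i x) - e) * (cut b (Z j x) - e))\<bar> \<le> 0" by simp
    next
      fix i x show "\<bar>cut b (Z i x) - e\<bar> \<le> real b + \<bar>e\<bar>" using cut_bnd[of b "Z i x"] by linarith
    qed auto
    then obtain N where N: "\<And>n. n \<ge> N \<Longrightarrow>
        expectation (\<lambda>x. \<bar>(\<Sum>i=1..n. (cut b (Z i x) - e)) / real n\<bar>) < \<epsilon> / 3"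
      using LIMSEQ_D[of _ 0 "\<epsilon> / 3"] \<epsilon> by (force simp: abs_less_iff)
    have "norm (expectation (\<lambda>x. \<bar>(\<Sum>i=1..n. Z i x) / real n - expectation (Z 1)\<bar>) - 0) < \<epsilon>"
      if n: "n \<ge> max N 1" for n
    proof -
      have int_Z: "integrable M (Z i)" if "1 \<le> i" for i
        using transfer_int[OF that, of "\<lambda>x. x"] int by simp
      have e_diff: "\<bar>e - expectation (Z 1)\<bar> \<le> \<delta> b"
      proof -
        have "\<bar>e - expectation (Z 1)\<bar> = \<bar>expectation (\<lambda>x. cut b (Z 1 x) - Z 1 x)\<bar>"
          using int int_cut[of 1] by (simp add: e_def)
        also have "\<dots> \<le> expectation (\<lambda>x. \<bar>cut b (Z 1 x) - Z 1 x\<bar>)" by (rule integral_abs_bound)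
        finally show ?thesis by (simp add: \<delta>_def abs_minus_commute)
      qed
      \<comment> \<open>Clamping error, fluctuation of the clamped variables, and shift of the mean:
        each is below \<epsilon> / 3 in expectation.\<close>
      have pw: "\<bar>(\<Sum>i=1..n. Z i x) / real n - expectation (Z 1)\<bar> \<le>
          (\<Sum>i=1..n. \<bar>Z i x - cut b (Z i x)\<bar>) / real n +
          (\<bar>(\<Sum>i=1..n. (cut b (Z i x) - e)) / real n\<bar> + \<delta> b)" for x
      proof -
        have "(\<Sum>i=1..n. Z i x) / real n - expectation (Z 1) =
            (\<Sum>i=1..n. Z i x - cut b (Z i x)) / real n + (\<Sum>i=1..n. (cut b (Z i x) - e)) / real n
            + (e - expectation (Z 1))"
          using n by (simp add: sum_subtractf field_simps)
        moreover have "\<bar>(\<Sum>i=1..n. Z i x - cut b (Z i x)) / real n\<bar>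
            \<le> (\<Sum>i=1..n. \<bar>Z i x - cut b (Z i x)\<bar>) / real n"
          by (simp add: divide_right_mono)
        ultimately show ?thesis using e_diff by linarith
      qed
      have i1: "integrable M (\<lambda>x. \<bar>Z i x - cut b (Z i x)\<bar>)" if "1 \<le> i" for i
        using int_Z[OF that] int_cut[OF that] by auto
      have i2: "integrable M (\<lambda>x. \<bar>(\<Sum>i=1..n. (cut b (Z i x) - e)) / real n\<bar>)"
        by (intro integrable_abs integrable_divide Bochner_Integration.integrable_sum
            Bochner_Integration.integrable_diff int_cut) auto
      have i3: "integrable M (\<lambda>x. (\<Sum>i=1..n. \<bar>Z i x - cut b (Z i x)\<bar>) / real n)"
        by (intro integrable_divide Bochner_Integration.integrable_sum i1) auto
      have i4: "integrable M (\<lambda>x. \<bar>(\<Sum>i=1..n. Z i x) / real n - expectation (Z 1)\<bar>)"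
        by (intro integrable_abs integrable_divide Bochner_Integration.integrable_sum
            Bochner_Integration.integrable_diff int_Z) auto
      have "expectation (\<lambda>x. \<bar>(\<Sum>i=1..n. Z i x) / real n - expectation (Z 1)\<bar>) \<le>
          expectation (\<lambda>x. (\<Sum>i=1..n. \<bar>Z i x - cut b (Z i x)\<bar>) / real n +
          (\<bar>(\<Sum>i=1..n. (cut b (Z i x) - e)) / real n\<bar> + \<delta> b))"
        using i2 i3 i4 pw by (intro integral_mono) auto
      also have "\<dots> = (\<Sum>i=1..n. expectation (\<lambda>x. \<bar>Z i x - cut b (Z i x)\<bar>)) / real n +
          (expectation (\<lambda>x. \<bar>(\<Sum>i=1..n. (cut b (Z i x) - e)) / real n\<bar>) + \<delta> b)"
        using i1 i2 i3 by (simp add: prob_space Bochner_Integration.integral_sum)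
      also have "(\<Sum>i=1..n. expectation (\<lambda>x. \<bar>Z i x - cut b (Z i x)\<bar>)) = (\<Sum>i=1..n. \<delta> b)"
        unfolding \<delta>_def by (intro sum.cong refl transfer) auto
      also have "(\<Sum>i=1..n. \<delta> b) / real n = \<delta> b" using n by simp
      finally have "expectation (\<lambda>x. \<bar>(\<Sum>i=1..n. Z i x) / real n - expectation (Z 1)\<bar>) < \<epsilon>"
        using b N[of n] n by linarith
      moreover have "0 \<le> expectation (\<lambda>x. \<bar>(\<Sum>i=1..n. Z i x) / real n - expectation (Z 1)\<bar>)"
        by (intro Bochner_Integration.integral_nonneg) auto
      ultimately show ?thesis by simp
    qed
    then show "\<exists>no. \<forall>n\<ge>no. norm (expectation (\<lambda>x. \<bar>(\<Sum>i=1..n. Z i x) / real n - expectation (Z 1)\<bar>) - 0) < \<epsilon>"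
      by blast
  qed
qed

end

section \<open>Weak limits of sequences that are Cauchy in total variation\<close>

text \<open>
  Weak convergence alone does not control measurable test functions; here it only identifies the
  limit of a sequence that is Cauchy in total variation.
\<close>

locale total_variation_Cauchy = real_distribution \<pi> for \<pi> :: "real measure" +
  fixes \<mu> :: "nat \<Rightarrow> real measure" and e :: "nat \<Rightarrow> real"
  assumes real_distribution_seq: "\<And>d. real_distribution (\<mu> d)"
    and weak_conv: "weak_conv_m \<mu> \<pi>"
    and Cauchy: "\<And>h i d. h \<in> borel_measurable borel \<Longrightarrow> (\<And>x. 0 \<le> h x \<and> h x \<le> 1) \<Longrightarrow>
      \<bar>(\<integral>x. h x \<partial>\<mu> (i + d)) - (\<integral>x. h x \<partial>\<mu> d)\<bar> \<le> e d"
begin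

lemma e_nonneg: "0 \<le> e d"
  using Cauchy[of "\<lambda>_. 0" 0 d] by simp

text \<open>Weak convergence lets \<open>i\<close> tend to infinity in the Cauchy bound while
  \<open>d\<close> stays fixed.\<close>

lemma integral_continuous_bound:
  fixes h :: "real \<Rightarrow> real"
  assumes cont: "\<And>x. isCont h x" and range: "\<And>x. 0 \<le> h x \<and> h x \<le> 1"
  shows "\<bar>(\<integral>x. h x \<partial>\<pi>) - (\<integral>x. h x \<partial>\<mu> d)\<bar> \<le> e d"
proof -
  have meas: "h \<in> borel_measurable borel"
    using cont by (auto intro!: borel_measurable_continuous_onI continuous_at_imp_continuous_on)
  have "(\<lambda>i. \<integral>x. h x \<partial>\<mu> i) \<longlonglongrightarrow> (\<integral>x. h x \<partial>\<pi>)"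
    using real_distribution_seq real_distribution_axioms weak_conv cont
    by (rule weak_conv_imp_integral_bdd_continuous_conv[where B=1]) (use range in auto)
  then have "(\<lambda>i. \<integral>x. h x \<partial>\<mu> (i + d)) \<longlonglongrightarrow> (\<integral>x. h x \<partial>\<pi>)" by (rule LIMSEQ_ignore_initial_segment)
  then have "(\<lambda>i. \<bar>(\<integral>x. h x \<partial>\<mu> (i + d)) - (\<integral>x. h x \<partial>\<mu> d)\<bar>) \<longlonglongrightarrow> \<bar>(\<integral>x. h x \<partial>\<pi>) - (\<integral>x. h x \<partial>\<mu> d)\<bar>"
    by (intro tendsto_intros)
  then show ?thesis
    using Cauchy[OF meas range] by (intro LIMSEQ_le_const2) auto
qed

text \<open>The indicator of an open set is the pointwise limit of continuous functions, the
  multiples of the distance to the complement capped at 1.\<close>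

lemma open_bound:
  assumes A: "open A"
  shows "\<bar>measure \<pi> A - measure (\<mu> d) A\<bar> \<le> e d"
proof (cases "A = UNIV")
  \<comment> \<open>The distance to an empty complement is 0 by convention, so the approximation of
    the other case would yield 0 instead of 1.\<close>
  case True
  interpret \<mu>: real_distribution "\<mu> d" by (rule real_distribution_seq)
  show ?thesis using prob_space \<mu>.prob_space e_nonneg[of d] by (simp add: True)
next
  case False
  define h where "h k x = min 1 (real k * infdist x (- A))" for k x
  have h_range: "0 \<le> h k x \<and> h k x \<le> 1" for k x by (simp add: h_def infdist_nonneg)
  have h_cont: "isCont (h k) x" for k x
    unfolding h_def by (intro continuous_intros)
  have h_meas: "h k \<in> borel_measurable borel" for k
    using h_cont by (auto intro!: borel_measurable_continuous_onI continuous_at_imp_continuous_on)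
  have h_lim: "(\<lambda>k. h k x) \<longlonglongrightarrow> indicator A x" for x
  proof (cases "x \<in> A")
    case True
    then have "0 < infdist x (- A)"
      using A False in_closed_iff_infdist_zero[of "- A" x] infdist_nonneg[of x "- A"]
      by (auto simp: less_le closed_Compl)
    then obtain N :: nat where N: "1 < real N * infdist x (- A)" using reals_Archimedean3 by blast
    have "\<forall>\<^sub>F k in sequentially. h k x = 1"
      using eventually_ge_at_top[of N]
    proof eventually_elim
      case (elim k)
      then have "real N * infdist x (- A) \<le> real k * infdist x (- A)"
        by (intro mult_right_mono) (auto simp: infdist_nonneg)
      then show ?case using N by (simp add: h_def)
    qed
    then show ?thesis using True by (simp add: tendsto_eventually)
  qed (simp add: h_def)
  have lim: "(\<lambda>k. \<integral>x. h k x \<partial>\<nu>) \<longlonglongrightarrow> measure \<nu> A" if "real_distribution \<nu>" for \<nu>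
  proof -
    interpret \<nu>: real_distribution \<nu> by fact
    have "(\<lambda>k. \<integral>x. h k x \<partial>\<nu>) \<longlonglongrightarrow> (\<integral>x. indicator A x \<partial>\<nu>)"
      using h_meas h_lim h_range A
      by (intro integral_dominated_convergence[where w="\<lambda>_. 1"]) auto
    then show ?thesis using A by simp
  qed
  have "(\<lambda>k. \<bar>(\<integral>x. h k x \<partial>\<pi>) - (\<integral>x. h k x \<partial>\<mu> d)\<bar>) \<longlonglongrightarrow> \<bar>measure \<pi> A - measure (\<mu> d) A\<bar>"
    using real_distribution_seq real_distribution_axioms by (intro tendsto_intros lim)
  then show ?thesis
    using integral_continuous_bound[OF h_cont h_range] by (intro LIMSEQ_le_const2) auto
qed

lemma outer_approx:
  fixes \<nu> :: "real measure"
  assumes "real_distribution \<nu>" and A: "A \<in> sets borel" and \<eta>: "0 < \<eta>"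
  obtains U where "A \<subseteq> U" "open U" "measure \<nu> U < measure \<nu> A + \<eta>"
proof -
  interpret \<nu>: real_distribution \<nu> by fact
  have "(INF U \<in> {U. A \<subseteq> U \<and> open U}. emeasure \<nu> U) < ennreal (measure \<nu> A + \<eta>)"
    unfolding outer_regular[OF \<nu>.events_eq_borel \<nu>.emeasure_finite[of "space \<nu>", folded infinity_ennreal_def] A, symmetric]
    using \<eta> by (simp add: \<nu>.emeasure_eq_measure ennreal_less_iff)
  then obtain U where U: "A \<subseteq> U" "open U" "emeasure \<nu> U < ennreal (measure \<nu> A + \<eta>)"
    unfolding INF_less_iff by blast
  then have "measure \<nu> U < measure \<nu> A + \<eta>"
    by (simp add: \<nu>.emeasure_eq_measure ennreal_less_iff)
  with U show thesis by (intro that)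
qed

text \<open>Outer regularity supplies one open superset per measure. Their intersection is open and
  close to \<open>A\<close> under both measures at once.\<close>

lemma measure_bound:
  assumes A: "A \<in> sets borel"
  shows "\<bar>measure \<pi> A - measure (\<mu> d) A\<bar> \<le> e d"
proof (rule field_le_epsilon)
  fix \<eta> :: real assume \<eta>: "0 < \<eta>"
  interpret \<mu>: real_distribution "\<mu> d" by (rule real_distribution_seq)
  obtain U where U: "A \<subseteq> U" "open U" "measure \<pi> U < measure \<pi> A + \<eta>"
    using outer_approx[OF real_distribution_axioms A \<eta>] by blast
  obtain V where V: "A \<subseteq> V" "open V" "measure (\<mu> d) V < measure (\<mu> d) A + \<eta>"
    using outer_approx[OF real_distribution_seq A \<eta>] by blast
  have UV: "open (U \<inter> V)" using U V by auto
  have "measure \<pi> A \<le> measure \<pi> (U \<inter> V)" "measure \<pi> (U \<inter> V) \<le> measure \<pi> U"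
    using U V by (auto intro!: finite_measure_mono)
  moreover have "measure (\<mu> d) A \<le> measure (\<mu> d) (U \<inter> V)" "measure (\<mu> d) (U \<inter> V) \<le> measure (\<mu> d) V"
    using U V by (auto intro!: \<mu>.finite_measure_mono)
  ultimately show "\<bar>measure \<pi> A - measure (\<mu> d) A\<bar> \<le> e d + \<eta>"
    using open_bound[OF UV, of d] U(3) V(3) by linarith
qed

text \<open>Layer-cake decomposition: \<open>s\<close> rounds \<open>h\<close> down to a multiple of
  \<open>1 / k\<close> and is an average of indicators of superlevel sets. An average of the bounds
  \<open>e d\<close> is again \<open>e d\<close>, so no constant is lost. Rounding is paid once per
  measure, whence \<open>2 / \<eta> < real k\<close>.\<close>

lemma integral_bound:
  fixes h :: "real \<Rightarrow> real"
  assumes meas[measurable]: "h \<in> borel_measurable borel" and range: "\<And>x. 0 \<le> h x \<and> h x \<le> 1"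
  shows "\<bar>(\<integral>x. h x \<partial>\<pi>) - (\<integral>x. h x \<partial>\<mu> d)\<bar> \<le> e d"
proof (rule field_le_epsilon)
  fix \<eta> :: real assume \<eta>: "0 < \<eta>"
  obtain k :: nat where k: "2 / \<eta> < real k" using reals_Archimedean2 by blast
  then have k0: "0 < real k" using \<eta> by (smt (verit) divide_pos_pos)
  define L where "L i = {x. real i \<le> real k * h x}" for i
  have L[measurable]: "L i \<in> sets borel" for i unfolding L_def by measurable
  define s where "s x = (\<Sum>i=1..k. indicat_real (L i) x) / real k" for x
  have s_near: "s x \<le> h x \<and> h x \<le> s x + 1 / real k" for x
  proof -
    define m where "m = nat \<lfloor>real k * h x\<rfloor>"
    have "0 \<le> real k * h x" using range by simp
    then have m: "real m \<le> real k * h x" "real k * h x < real m + 1"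
      unfolding m_def by linarith+
    have "real k * h x \<le> real k" using range[of x] k0 by (simp add: mult_le_cancel_left2)
    then have mk: "m \<le> k" using m(1) by linarith
    have "(\<Sum>i=1..k. indicat_real (L i) x) = real (card {i\<in>{1..k}. x \<in> L i})"
      by (simp add: indicator_def sum.If_cases Int_def)
    also have "{i\<in>{1..k}. x \<in> L i} = {1..m}"
      using m mk by (auto simp: L_def)
    finally have s: "s x = real m / real k" by (simp add: s_def)
    show ?thesis using m k0 by (simp add: s field_simps)
  qed
  have near: "\<bar>(\<integral>x. h x \<partial>\<nu>) - (\<Sum>i=1..k. measure \<nu> (L i)) / real k\<bar> \<le> 1 / real k"
    if "real_distribution \<nu>" for \<nu>
  proof -
    interpret \<nu>: real_distribution \<nu> by fact
    have h_int: "integrable \<nu> h"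
      using range by (intro \<nu>.integrable_const_bound[where B=1]) auto
    have L_int: "integrable \<nu> (indicat_real (L i))" for i
      by (intro \<nu>.integrable_const_bound[where B=1]) auto
    have s_int: "integrable \<nu> s" unfolding s_def
      by (intro integrable_divide Bochner_Integration.integrable_sum L_int)
    have "(\<integral>x. s x \<partial>\<nu>) = (\<Sum>i=1..k. measure \<nu> (L i)) / real k"
      unfolding s_def by (simp only: integral_divide_zero Bochner_Integration.integral_sum[OF L_int]) simp
    moreover have "(\<integral>x. s x \<partial>\<nu>) \<le> (\<integral>x. h x \<partial>\<nu>)"
      using s_near by (intro integral_mono s_int h_int) auto
    moreover have "(\<integral>x. h x \<partial>\<nu>) \<le> (\<integral>x. s x + 1 / real k \<partial>\<nu>)"
      using s_near s_int by (intro integral_mono h_int) auto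
    ultimately show ?thesis using s_int \<nu>.prob_space by simp
  qed
  have "\<bar>(\<Sum>i=1..k. measure \<pi> (L i)) / real k - (\<Sum>i=1..k. measure (\<mu> d) (L i)) / real k\<bar>
      = \<bar>\<Sum>i=1..k. measure \<pi> (L i) - measure (\<mu> d) (L i)\<bar> / real k"
    using k0 by (simp add: sum_subtractf diff_divide_distrib[symmetric])
  also have "\<dots> \<le> (\<Sum>i=1..k. \<bar>measure \<pi> (L i) - measure (\<mu> d) (L i)\<bar>) / real k"
    by (intro divide_right_mono sum_abs) simp
  also have "\<dots> \<le> (\<Sum>i=1..k. e d) / real k"
    by (intro divide_right_mono sum_mono measure_bound L) simp
  also have "\<dots> = e d" using k0 by simp
  finally have "\<bar>(\<integral>x. h x \<partial>\<pi>) - (\<integral>x. h x \<partial>\<mu> d)\<bar> \<le> e d + 1 / real k + 1 / real k"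
    using near[OF real_distribution_axioms] near[OF real_distribution_seq[of d]] by linarith
  also have "\<dots> \<le> e d + \<eta>" using k k0 \<eta> by (simp add: field_simps)
  finally show "\<bar>(\<integral>x. h x \<partial>\<pi>) - (\<integral>x. h x \<partial>\<mu> d)\<bar> \<le> e d + \<eta>" .
qed

end

section \<open>The Lindley recursion\<close>

lemma sojourn_time_0 [simp]: "sojourn_time \<tau> S 0 \<omega> = 0"
  by (simp add: sojourn_time_def arrival_time_def)

text \<open>Lindley's recursion, with the service time included in the delay. A fictitious symbol 0
  that leaves at time 0 lets it cover the first symbol; no sign condition is involved.\<close>

lemma sojourn_time_Suc:
  "sojourn_time \<tau> S (Suc j) \<omega> = max (sojourn_time \<tau> S j \<omega> - \<tau> (Suc j) \<omega>) 0 + S (Suc j) \<omega>"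
  by (simp add: sojourn_time_def arrival_time_def max_def)

lemma sojourn_time_nonneg:
  assumes "\<And>k. k \<in> {1..j} \<Longrightarrow> 0 \<le> S k \<omega>"
  shows "0 \<le> sojourn_time \<tau> S j \<omega>"
  using assms by (cases j) (auto simp: sojourn_time_Suc)

text \<open>Two different sample spaces are allowed so that the same recursion can be read on the
  coordinates of a product space; this yields the functionals \<open>G\<close> and \<open>H\<close>
  of the shift and independence arguments.\<close>

lemma sojourn_time_cong:
  assumes "\<And>k. k \<in> {1..j} \<Longrightarrow> \<tau> k \<omega> = \<tau>' k \<omega>'" "\<And>k. k \<in> {1..j} \<Longrightarrow> S k \<omega> = S' k \<omega>'"
  shows "sojourn_time \<tau> S j \<omega> = sojourn_time \<tau>' S' j \<omega>'"
  using assms by (induction j) (auto simp: sojourn_time_Suc)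

lemma sojourn_time_measurable:
  assumes "\<And>k. k \<in> {1..j} \<Longrightarrow> \<tau> k \<in> borel_measurable M" "\<And>k. k \<in> {1..j} \<Longrightarrow> S k \<in> borel_measurable M"
  shows "sojourn_time \<tau> S j \<in> borel_measurable M"
  using assms
proof (induction j)
  case 0
  then show ?case by (simp add: sojourn_time_def arrival_time_def[abs_def])
next
  case (Suc j)
  have [measurable]: "sojourn_time \<tau> S j \<in> borel_measurable M" using Suc by auto
  have [measurable]: "\<tau> (Suc j) \<in> borel_measurable M" "S (Suc j) \<in> borel_measurable M"
    using Suc.prems by auto
  show ?case unfolding sojourn_time_Suc[abs_def] by measurable
qed

text \<open>
  The workload restarted from the empty system at time \<open>i\<close> lies below the true one, and the two
  merge as soon as the true one empties; until then the true one is the unreflected random walk.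
\<close>

lemma sojourn_time_coupling:
  fixes \<tau> S :: "nat \<Rightarrow> 'w \<Rightarrow> real" and i :: nat
  defines "\<tau>' \<equiv> \<lambda>k. \<tau> (i + k)" and "S' \<equiv> \<lambda>k. S (i + k)"
  assumes nonneg: "\<And>k. k \<in> {1..i + d} \<Longrightarrow> 0 \<le> S k \<omega>"
  shows "sojourn_time \<tau>' S' d \<omega> \<le> sojourn_time \<tau> S (i + d) \<omega> \<and>
    (sojourn_time \<tau> S (i + d) \<omega> = sojourn_time \<tau>' S' d \<omega> \<or>
     sojourn_time \<tau> S (i + d) \<omega> = sojourn_time \<tau> S i \<omega> - (\<Sum>k=1..d. \<tau>' k \<omega> - S' k \<omega>))"
  using nonneg
proof (induction d)
  case 0
  then show ?case by (auto intro: sojourn_time_nonneg)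
next
  case (Suc d)
  have "0 \<le> S k \<omega>" if "k \<in> {1..i + d}" for k using Suc.prems that by auto
  from Suc.IH[OF this] show ?case
    by (auto simp: sojourn_time_Suc \<tau>'_def S'_def)
qed

text \<open>Without coupling, the true sojourn time is still
  \<open>sojourn_time \<tau> S i \<omega>\<close> minus the drift, and it cannot be
  negative.\<close>

lemma drift_le_of_not_coupled:
  assumes "\<And>k. k \<in> {1..i + d} \<Longrightarrow> 0 \<le> S k \<omega>"
    and "sojourn_time \<tau> S (i + d) \<omega> \<noteq> sojourn_time (\<lambda>k. \<tau> (i + k)) (\<lambda>k. S (i + k)) d \<omega>"
  shows "(\<Sum>k=1..d. \<tau> (i + k) \<omega> - S (i + k) \<omega>) \<le> sojourn_time \<tau> S i \<omega>"
  using sojourn_time_coupling[where \<tau>=\<tau> and S=S and i=i and d=d and \<omega>=\<omega>] assms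
    sojourn_time_nonneg[of "i + d" S \<omega> \<tau>] by auto

section \<open>Shift invariance and independence of the driving sequence\<close>

lemma (in prob_space) indep_vars_reindex:
  assumes inj: "inj_on f I" and indep: "indep_vars M' X (f ` I)"
  shows "indep_vars (\<lambda>i. M' (f i)) (\<lambda>i. X (f i)) I"
  unfolding indep_vars_def2 indep_sets_def
proof (intro conjI ballI allI impI)
  have rv: "random_variable (M' (f i)) (X (f i))" if "i \<in> I" for i
    using indep that by (auto simp: indep_vars_def2)
  fix i assume i: "i \<in> I"
  show "random_variable (M' (f i)) (X (f i))" using rv[OF i] .
  show "{X (f i) -` A \<inter> space M |A. A \<in> sets (M' (f i))} \<subseteq> events"
    using rv[OF i] by (auto intro: measurable_sets)
next
  fix J A assume J: "J \<subseteq> I" "J \<noteq> {}" "finite J"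
    and A: "A \<in> (\<Pi> j\<in>J. {X (f j) -` B \<inter> space M |B. B \<in> sets (M' (f j))})"
  have inj_J: "inj_on f J" using inj J(1) by (rule inj_on_subset)
  \<comment> \<open>Independence of the family over the image of \<open>J\<close> speaks about
    events indexed there, so the given events are carried over by the inverse of
    \<open>f\<close>.\<close>
  define A' where "A' = A \<circ> the_inv_into J f"
  have A': "A' (f j) = A j" if "j \<in> J" for j
    by (simp add: A'_def the_inv_into_f_f[OF inj_J that])
  have "A' \<in> (\<Pi> l\<in>f ` J. {X l -` B \<inter> space M |B. B \<in> sets (M' l)})"
  proof (rule Pi_I)
    fix l assume "l \<in> f ` J"
    then obtain j where j: "j \<in> J" "l = f j" by auto
    show "A' l \<in> {X l -` B \<inter> space M |B. B \<in> sets (M' l)}"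
      using Pi_mem[OF A j(1)] unfolding j(2) A'[OF j(1)] .
  qed
  then have "prob (\<Inter>l\<in>f ` J. A' l) = (\<Prod>l\<in>f ` J. prob (A' l))"
    by (intro indep[unfolded indep_vars_def2 indep_sets_def, THEN conjunct2, THEN conjunct2, rule_format])
      (use J in auto)
  then show "prob (\<Inter>j\<in>J. A j) = (\<Prod>j\<in>J. prob (A j))"
    using A' by (simp add: prod.reindex[OF inj_J])
qed

context mgi1_queue
begin

abbreviation primitive :: "nat + nat \<Rightarrow> 'w \<Rightarrow> real" where
  "primitive \<equiv> case_sum \<tau> S"

lemma \<tau>_measurable [measurable]: "1 \<le> j \<Longrightarrow> \<tau> j \<in> borel_measurable Q"
  using conjunct1[OF independent[unfolded indep_vars_def2], THEN bspec, of "Inl j"] by auto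

lemma S_measurable [measurable]: "1 \<le> j \<Longrightarrow> S j \<in> borel_measurable Q"
  using conjunct1[OF independent[unfolded indep_vars_def2], THEN bspec, of "Inr j"] by auto

lemma distr_\<tau>: "1 \<le> j \<Longrightarrow> distr Q borel (\<tau> j) = density lborel (exponential_density lam)"
  using distributed_distr_eq_density[OF interarrival] by (simp cong: distr_cong)

lemma distr_S: "1 \<le> j \<Longrightarrow> distr Q borel (S j) = distr Q borel (S 1)"
  using service_cdf by (intro cdf_unique) (simp_all add: real_distribution_distr)

lemma \<tau>_nonneg: "1 \<le> j \<Longrightarrow> AE \<omega> in Q. 0 \<le> \<tau> j \<omega>"
  by (subst distributed_AE2[OF interarrival]) (auto simp: exponential_density_def)

lemma integrable_\<tau>: "1 \<le> j \<Longrightarrow> integrable Q (\<tau> j)"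
  using has_bochner_integral_erlang_ith_moment[OF lam_pos, of "\<tau> j" 0 1] interarrival
  by (auto simp: has_bochner_integral_iff)

lemma expectation_\<tau>: "1 \<le> j \<Longrightarrow> expectation (\<tau> j) = 1 / lam"
  using exponential_distributed_expectation[OF lam_pos interarrival] .

lemma W_measurable [measurable]: "sojourn_time \<tau> S j \<in> borel_measurable Q"
  by (intro sojourn_time_measurable) auto

lemma W_shift_measurable [measurable]:
  "sojourn_time (\<lambda>k. \<tau> (i + k)) (\<lambda>k. S (i + k)) j \<in> borel_measurable Q"
  by (intro sojourn_time_measurable) auto

lemma AE_S_nonneg: "AE \<omega> in Q. \<forall>j\<ge>1. 0 \<le> S j \<omega>"
  using service_nonneg by (simp add: AE_all_countable)

lemma AE_\<tau>_nonneg: "AE \<omega> in Q. \<forall>j\<ge>1. 0 \<le> \<tau> j \<omega>"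
  using \<tau>_nonneg by (simp add: AE_all_countable)

lemma AE_W_nonneg: "AE \<omega> in Q. \<forall>j. 0 \<le> sojourn_time \<tau> S j \<omega>"
  using AE_S_nonneg by eventually_elim (auto intro: sojourn_time_nonneg)

abbreviation index :: "(nat + nat) set" where
  "index \<equiv> {1..} <+> {1..}"

text \<open>The sequence and its shift are both independent with the same marginals, so both have
  the same product law, and every measurable functional of them has the same distribution.\<close>

lemma shift_law:
  assumes G: "G \<in> measurable (\<Pi>\<^sub>M x\<in>index. borel) N"
  shows "distr Q N (\<lambda>\<omega>. G (\<lambda>x\<in>index. primitive (map_sum ((+) i) ((+) i) x) \<omega>)) =
    distr Q N (\<lambda>\<omega>. G (\<lambda>x\<in>index. primitive x \<omega>))"
proof -
  let ?P = "\<Pi>\<^sub>M x\<in>index. (borel :: real measure)" and ?s = "map_sum ((+) i) ((+) i)"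
  have ne: "index \<noteq> {}" by auto
  have rv: "primitive x \<in> borel_measurable Q" if "x \<in> index" for x
    using that by auto
  have sub: "?s ` index \<subseteq> index" by auto
  have rv': "(\<lambda>\<omega>. primitive (?s x) \<omega>) \<in> borel_measurable Q" if "x \<in> index" for x
    using rv sub that by blast
  have "inj_on ?s index" by (auto simp: inj_on_def)
  moreover have "indep_vars (\<lambda>_. borel) primitive (?s ` index)"
    using independent sub by (rule indep_vars_subset)
  ultimately have "indep_vars (\<lambda>_. borel) (\<lambda>x. primitive (?s x)) index"
    by (rule indep_vars_reindex)
  then have "distr Q ?P (\<lambda>\<omega>. \<lambda>x\<in>index. primitive (?s x) \<omega>) =
      (\<Pi>\<^sub>M x\<in>index. distr Q borel (primitive (?s x)))"
    using indep_vars_iff_distr_eq_PiM'[OF ne rv'] by simp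
  also have "\<dots> = (\<Pi>\<^sub>M x\<in>index. distr Q borel (primitive x))"
  proof (rule PiM_cong)
    fix x assume x: "x \<in> index"
    show "distr Q borel (primitive (?s x)) = distr Q borel (primitive x)"
    proof (cases x)
      case (Inl j)
      then have "1 \<le> j" using x by auto
      then show ?thesis using distr_\<tau>[of j] distr_\<tau>[of "i + j"] by (simp add: Inl)
    next
      case (Inr j)
      then have "1 \<le> j" using x by auto
      then show ?thesis using distr_S[of j] distr_S[of "i + j"] by (simp add: Inr)
    qed
  qed (rule refl)
  also have "\<dots> = distr Q ?P (\<lambda>\<omega>. \<lambda>x\<in>index. primitive x \<omega>)"
    by (rule indep_vars_iff_distr_eq_PiM'[OF ne rv, THEN iffD1, OF _ independent, symmetric])
  finally have eq: "distr Q ?P (\<lambda>\<omega>. \<lambda>x\<in>index. primitive (?s x) \<omega>) =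
      distr Q ?P (\<lambda>\<omega>. \<lambda>x\<in>index. primitive x \<omega>)" .
  have "distr (distr Q ?P (\<lambda>\<omega>. \<lambda>x\<in>index. primitive (?s x) \<omega>)) N G =
      distr (distr Q ?P (\<lambda>\<omega>. \<lambda>x\<in>index. primitive x \<omega>)) N G"
    by (simp only: eq)
  then show ?thesis
    using G rv rv' by (simp add: distr_distr measurable_restrict comp_def)
qed

lemma distr_W_shift:
  "distr Q borel (sojourn_time (\<lambda>k. \<tau> (i + k)) (\<lambda>k. S (i + k)) d) = distr Q borel (sojourn_time \<tau> S d)"
proof -
  define G where "G = sojourn_time (\<lambda>j z. z (Inl j)) (\<lambda>j z. z (Inr j :: nat + nat) :: real) d"
  have G: "G \<in> measurable (\<Pi>\<^sub>M x\<in>index. borel) borel"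
    unfolding G_def by (intro sojourn_time_measurable measurable_component_singleton) auto
  have "sojourn_time (\<lambda>k. \<tau> (i + k)) (\<lambda>k. S (i + k)) d =
      (\<lambda>\<omega>. G (\<lambda>x\<in>index. primitive (map_sum ((+) i) ((+) i) x) \<omega>))"
    unfolding G_def by (intro ext sojourn_time_cong) auto
  moreover have "sojourn_time \<tau> S d = (\<lambda>\<omega>. G (\<lambda>x\<in>index. primitive x \<omega>))"
    unfolding G_def by (intro ext sojourn_time_cong) auto
  ultimately show ?thesis using shift_law[OF G] by simp
qed

lemma distr_drift_shift:
  "distr Q borel (\<lambda>\<omega>. \<Sum>k=1..d. \<tau> (i + k) \<omega> - S (i + k) \<omega>) =
   distr Q borel (\<lambda>\<omega>. \<Sum>k=1..d. \<tau> k \<omega> - S k \<omega>)"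
proof -
  define G where "G z = (\<Sum>k=1..d. z (Inl k) - z (Inr k))" for z :: "nat + nat \<Rightarrow> real"
  have G: "G \<in> measurable (\<Pi>\<^sub>M x\<in>index. borel) borel"
    unfolding G_def
    by (intro borel_measurable_sum borel_measurable_diff measurable_component_singleton) auto
  have "(\<lambda>\<omega>. \<Sum>k=1..d. \<tau> (i + k) \<omega> - S (i + k) \<omega>) =
      (\<lambda>\<omega>. G (\<lambda>x\<in>index. primitive (map_sum ((+) i) ((+) i) x) \<omega>))"
    unfolding G_def by (intro ext sum.cong) auto
  moreover have "(\<lambda>\<omega>. \<Sum>k=1..d. \<tau> k \<omega> - S k \<omega>) = (\<lambda>\<omega>. G (\<lambda>x\<in>index. primitive x \<omega>))"
    unfolding G_def by (intro ext sum.cong) auto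
  ultimately show ?thesis using shift_law[OF G] by simp
qed

text \<open>The two queues are driven by disjoint blocks of inputs, those up to \<open>i\<close> and
  those from \<open>i + 1\<close> on.\<close>

lemma indep_W_W_shift:
  "indep_var borel (sojourn_time \<tau> S i)
     borel (sojourn_time (\<lambda>k. \<tau> (i + k)) (\<lambda>k. S (i + k)) d)"
proof -
  let ?K = "{1..i} <+> {1..i}" and ?L = "{i+1..i+d} <+> {i+1..i+d}"
  define G where "G = sojourn_time (\<lambda>j z. z (Inl j)) (\<lambda>j z. z (Inr j :: nat + nat) :: real) i"
  define H where "H = sojourn_time (\<lambda>j z. z (Inl (i + j))) (\<lambda>j z. z (Inr (i + j) :: nat + nat) :: real) d"
  have "indep_var (\<Pi>\<^sub>M x\<in>?K. borel) (\<lambda>\<omega>. restrict (\<lambda>x. primitive x \<omega>) ?K)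
      (\<Pi>\<^sub>M x\<in>?L. borel) (\<lambda>\<omega>. restrict (\<lambda>x. primitive x \<omega>) ?L)"
    by (rule indep_var_restrict[OF independent]) auto
  moreover have "G \<in> measurable (\<Pi>\<^sub>M x\<in>?K. borel) borel"
    unfolding G_def by (intro sojourn_time_measurable measurable_component_singleton) auto
  moreover have "H \<in> measurable (\<Pi>\<^sub>M x\<in>?L. borel) borel"
    unfolding H_def by (intro sojourn_time_measurable measurable_component_singleton) auto
  ultimately have "indep_var borel (G \<circ> (\<lambda>\<omega>. restrict (\<lambda>x. primitive x \<omega>) ?K))
      borel (H \<circ> (\<lambda>\<omega>. restrict (\<lambda>x. primitive x \<omega>) ?L))"
    by (rule indep_var_compose)
  moreover have "G \<circ> (\<lambda>\<omega>. restrict (\<lambda>x. primitive x \<omega>) ?K) = sojourn_time \<tau> S i"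
    unfolding G_def comp_def by (intro ext sojourn_time_cong) auto
  moreover have "H \<circ> (\<lambda>\<omega>. restrict (\<lambda>x. primitive x \<omega>) ?L) =
      sojourn_time (\<lambda>k. \<tau> (i + k)) (\<lambda>k. S (i + k)) d"
    unfolding H_def comp_def by (intro ext sojourn_time_cong) auto
  ultimately show ?thesis by simp
qed

text \<open>Stability enters here: the mean drift per symbol is \<open>1 / lam - 1\<close>, which is
  positive. The weak law and Markov's inequality do the rest.\<close>

lemma drift_tendsto_infinity:
  "(\<lambda>d. prob {\<omega>\<in>space Q. (\<Sum>k=1..d. \<tau> k \<omega> - S k \<omega>) \<le> M}) \<longlonglongrightarrow> 0"
proof -
  define Z where "Z k \<omega> = \<tau> k \<omega> - S k \<omega>" for k \<omega>
  define \<mu> where "\<mu> = 1 / lam - 1"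
  have \<mu>: "0 < \<mu>" using lam_pos lam_less_1 by (simp add: \<mu>_def field_simps)
  have Z_meas[measurable]: "Z k \<in> borel_measurable Q" if "1 \<le> k" for k
    using that unfolding Z_def by measurable
  have Z_int: "integrable Q (Z k)" if "1 \<le> k" for k
    using integrable_\<tau>[OF that] service_integrable[OF that] unfolding Z_def by auto
  have Z_mean: "expectation (Z 1) = \<mu>"
    using integrable_\<tau>[of 1] service_integrable[of 1] expectation_\<tau>[of 1] service_mean[of 1]
    by (simp add: Z_def[abs_def] \<mu>_def)
  have Z_ident: "distr Q borel (Z i) = distr Q borel (Z 1)" if "1 \<le> i" for i
  proof -
    obtain l where l: "i = l + 1" using \<open>1 \<le> i\<close> by (metis add.commute le_Suc_ex)
    show ?thesis using distr_drift_shift[of l 1] by (simp add: Z_def[abs_def] l)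
  qed
  have Z_indep: "indep_var borel (Z i) borel (Z j)" if ij: "1 \<le> i" "i < j" for i j
  proof -
    let ?K = "{Inl i, Inr i :: nat + nat}" and ?L = "{Inl j, Inr j :: nat + nat}"
    have "indep_var (\<Pi>\<^sub>M x\<in>?K. borel) (\<lambda>\<omega>. restrict (\<lambda>x. primitive x \<omega>) ?K)
        (\<Pi>\<^sub>M x\<in>?L. borel) (\<lambda>\<omega>. restrict (\<lambda>x. primitive x \<omega>) ?L)"
      by (rule indep_var_restrict[OF independent]) (use ij in auto)
    moreover have "(\<lambda>z. z (Inl i) - z (Inr i) :: real) \<in> borel_measurable (\<Pi>\<^sub>M x\<in>?K. borel)"
      by (intro borel_measurable_diff measurable_component_singleton) auto
    moreover have "(\<lambda>z. z (Inl j) - z (Inr j) :: real) \<in> borel_measurable (\<Pi>\<^sub>M x\<in>?L. borel)"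
      by (intro borel_measurable_diff measurable_component_singleton) auto
    ultimately have "indep_var
        borel ((\<lambda>z. z (Inl i) - z (Inr i)) \<circ> (\<lambda>\<omega>. restrict (\<lambda>x. primitive x \<omega>) ?K))
        borel ((\<lambda>z. z (Inl j) - z (Inr j)) \<circ> (\<lambda>\<omega>. restrict (\<lambda>x. primitive x \<omega>) ?L))"
      by (rule indep_var_compose)
    then show ?thesis by (simp add: comp_def Z_def[abs_def])
  qed
  define v where "v n = expectation (\<lambda>\<omega>. \<bar>(\<Sum>k=1..n. Z k \<omega>) / real n - \<mu>\<bar>)" for n
  have "v \<longlonglongrightarrow> 0"
    unfolding v_def Z_mean[symmetric]
    by (rule weak_law_of_large_numbers_L1[where Z=Z]) (auto intro: Z_indep Z_ident Z_int simp del: One_nat_def)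
  then have lim: "(\<lambda>n. v n / (\<mu> / 2)) \<longlonglongrightarrow> 0"
    using \<mu> by (intro tendsto_divide_zero)
  \<comment> \<open>Beyond this index \<open>M\<close> is below \<open>n * \<mu> / 2\<close>, so a
    drift of at most \<open>M\<close> puts the average at least \<open>\<mu> / 2\<close> away from
    its mean.\<close>
  obtain N :: nat where N: "2 * \<bar>M\<bar> / \<mu> < real N" using reals_Archimedean2 by blast
  have "prob {\<omega>\<in>space Q. (\<Sum>k=1..n. \<tau> k \<omega> - S k \<omega>) \<le> M} \<le> v n / (\<mu> / 2)" if n: "n \<ge> max N 1" for n
  proof -
    have Mn: "2 * \<bar>M\<bar> < \<mu> * real n"
    proof -
      have "2 * \<bar>M\<bar> / \<mu> < real n" using N n by (meson le_less_trans less_le_trans max.boundedE of_nat_le_iff)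
      then show ?thesis using \<mu> by (simp add: pos_divide_less_eq mult.commute)
    qed
    have "prob {\<omega>\<in>space Q. (\<Sum>k=1..n. \<tau> k \<omega> - S k \<omega>) \<le> M} \<le>
        prob {\<omega>\<in>space Q. \<bar>(\<Sum>k=1..n. Z k \<omega>) / real n - \<mu>\<bar> \<ge> \<mu> / 2}"
    proof (rule finite_measure_mono)
      show "{\<omega>\<in>space Q. (\<Sum>k=1..n. \<tau> k \<omega> - S k \<omega>) \<le> M} \<subseteq>
          {\<omega>\<in>space Q. \<bar>(\<Sum>k=1..n. Z k \<omega>) / real n - \<mu>\<bar> \<ge> \<mu> / 2}"
      proof safe
        fix \<omega> assume le: "(\<Sum>k=1..n. \<tau> k \<omega> - S k \<omega>) \<le> M"
        have "(\<Sum>k=1..n. Z k \<omega>) \<le> real n * (\<mu> / 2)" using le Mn by (simp add: Z_def mult.commute)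
        then have "(\<Sum>k=1..n. Z k \<omega>) / real n \<le> \<mu> / 2" using n by (simp add: field_simps)
        then show "\<mu> / 2 \<le> \<bar>(\<Sum>k=1..n. Z k \<omega>) / real n - \<mu>\<bar>" by linarith
      qed
    qed measurable
    also have "\<dots> \<le> v n / (\<mu> / 2)"
      unfolding v_def
      by (intro integral_Markov_inequality_measure[where A="{}"] integrable_abs
          Bochner_Integration.integrable_diff integrable_divide Bochner_Integration.integrable_sum Z_int)
        (use \<mu> in auto)
    finally show ?thesis .
  qed
  then show ?thesis
    by (intro tendsto_sandwich[OF _ _ tendsto_const lim])
      (auto simp: eventually_sequentially intro!: exI[of _ "max N 1"])
qed

end

section \<open>Ergodicity of the sojourn times\<close>

lemma (in real_distribution) tail_small:
  assumes \<eta>: "0 < \<eta>"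
  obtains m :: real where "measure M {m<..} < \<eta>"
proof -
  have "\<forall>\<^sub>F x in at_top. 1 - \<eta> < cdf M x"
    using cdf_lim_at_top_prob \<eta> by (intro order_tendstoD(1)) auto
  then obtain m where "1 - \<eta> < cdf M m"
    by (auto simp: eventually_at_top_linorder)
  moreover have "measure M {m<..} = 1 - cdf M m"
  proof -
    have "measure M {m<..} = measure M (space M - {..m})"
      by (rule arg_cong[where f="measure M"]) auto
    then show ?thesis using prob_compl[of "{..m}"] by (simp add: cdf_def)
  qed
  ultimately show thesis by (intro that[of m]) simp
qed

lemma (in prob_space) indep_vars_imp_indep_var:
  assumes indep: "indep_vars M' X I" and ij: "i \<in> I" "j \<in> I" "i \<noteq> j"
  shows "indep_var (M' i) (X i) (M' j) (X j)"
proof -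
  have "indep_var (PiM {i} M') (\<lambda>\<omega>. restrict (\<lambda>x. X x \<omega>) {i}) (PiM {j} M') (\<lambda>\<omega>. restrict (\<lambda>x. X x \<omega>) {j})"
    by (rule indep_var_restrict[OF indep]) (use ij in auto)
  then have "indep_var (M' i) ((\<lambda>z. z i) \<circ> (\<lambda>\<omega>. restrict (\<lambda>x. X x \<omega>) {i}))
      (M' j) ((\<lambda>z. z j) \<circ> (\<lambda>\<omega>. restrict (\<lambda>x. X x \<omega>) {j}))"
    by (rule indep_var_compose) (auto intro: measurable_component_singleton)
  then show ?thesis by (simp add: comp_def)
qed

text \<open>The queue itself starts empty; stationarity refers only to the limit law
  \<open>\<pi>\<close>.\<close>

locale stationary_queue = mgi1_queue Q \<tau> S lam F
  for Q :: "'w measure" and \<tau> S lam F +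
  fixes \<pi> :: "real measure"
  assumes limit: "limiting_distribution Q (sojourn_time \<tau> S) \<pi>"
begin

abbreviation W :: "nat \<Rightarrow> 'w \<Rightarrow> real" where
  "W \<equiv> sojourn_time \<tau> S"

abbreviation restarted_W :: "nat \<Rightarrow> nat \<Rightarrow> 'w \<Rightarrow> real" where
  "restarted_W i d \<equiv> sojourn_time (\<lambda>k. \<tau> (i + k)) (\<lambda>k. S (i + k)) d"

lemma real_distribution_\<pi>: "real_distribution \<pi>"
  using limit by (simp add: limiting_distribution_def)

lemma real_distribution_W: "real_distribution (distr Q borel (W j))"
  by (simp add: real_distribution_distr)

lemma weak_conv_W: "weak_conv_m (\<lambda>j. distr Q borel (W j)) \<pi>"
  using limit by (simp add: limiting_distribution_def)

lemma prob_W_tail: "prob {\<omega>\<in>space Q. m < W i \<omega>} = measure (distr Q borel (W i)) {m<..}"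
  by (subst measure_distr) (auto intro!: arg_cong[where f=prob])

text \<open>Weak convergence does not see indicators of half-lines, so a ramp from \<open>m0\<close>
  to \<open>m0 + 1\<close> is tested instead: it lies below the indicator beyond \<open>m0\<close>
  and above the one beyond \<open>m0 + 1\<close>. The finitely many early indices are handled by
  their own tails.\<close>

lemma W_tight:
  assumes \<eta>: "0 < \<eta>"
  obtains m where "\<And>i. prob {\<omega>\<in>space Q. m < W i \<omega>} \<le> \<eta>"
proof -
  interpret \<pi>: real_distribution \<pi> by (rule real_distribution_\<pi>)
  obtain m0 where m0: "measure \<pi> {m0<..} < \<eta>" using \<pi>.tail_small[OF \<eta>] by blast
  define h where "h x = max 0 (min 1 (x - m0))" for x :: real
  have h_cont: "isCont h x" for x unfolding h_def by (intro continuous_intros)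
  have [measurable]: "h \<in> borel_measurable borel" unfolding h_def by measurable
  have "(\<lambda>i. \<integral>x. h x \<partial>distr Q borel (W i)) \<longlonglongrightarrow> (\<integral>x. h x \<partial>\<pi>)"
    using real_distribution_W real_distribution_\<pi> weak_conv_W h_cont
    by (rule weak_conv_imp_integral_bdd_continuous_conv[where B=1]) (auto simp: h_def)
  moreover have "(\<integral>x. h x \<partial>\<pi>) < \<eta>"
  proof -
    have "(\<integral>x. h x \<partial>\<pi>) \<le> (\<integral>x. indicat_real {m0<..} x \<partial>\<pi>)"
      by (intro integral_mono \<pi>.integrable_const_bound[where B=1])
        (auto simp: h_def indicator_def)
    then show ?thesis using m0 by simp
  qed
  ultimately have "\<forall>\<^sub>F i in sequentially. (\<integral>x. h x \<partial>distr Q borel (W i)) < \<eta>"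
    by (rule order_tendstoD(2))
  then obtain i0 where i0: "\<And>i. i \<ge> i0 \<Longrightarrow> (\<integral>x. h x \<partial>distr Q borel (W i)) < \<eta>"
    by (auto simp: eventually_sequentially)
  have late: "prob {\<omega>\<in>space Q. m0 + 1 < W i \<omega>} \<le> \<eta>" if "i \<ge> i0" for i
  proof -
    interpret W: real_distribution "distr Q borel (W i)" by (rule real_distribution_W)
    have "prob {\<omega>\<in>space Q. m0 + 1 < W i \<omega>} = (\<integral>x. indicat_real {m0 + 1<..} x \<partial>distr Q borel (W i))"
      by (simp add: prob_W_tail)
    also have "\<dots> \<le> (\<integral>x. h x \<partial>distr Q borel (W i))"
      by (intro integral_mono W.integrable_const_bound[where B=1]) (auto simp: h_def indicator_def)
    finally show ?thesis using i0[OF that] by simp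
  qed
  have "\<exists>m. \<forall>i<n. prob {\<omega>\<in>space Q. m < W i \<omega>} \<le> \<eta>" for n
  proof (induction n)
    case (Suc n)
    then obtain m1 where m1: "\<And>i. i < n \<Longrightarrow> prob {\<omega>\<in>space Q. m1 < W i \<omega>} \<le> \<eta>" by blast
    interpret W: real_distribution "distr Q borel (W n)" by (rule real_distribution_W)
    obtain m2 where m2: "prob {\<omega>\<in>space Q. m2 < W n \<omega>} < \<eta>"
      using W.tail_small[OF \<eta>] by (metis prob_W_tail)
    have "prob {\<omega>\<in>space Q. max m1 m2 < W i \<omega>} \<le> \<eta>" if "i < Suc n" for i
    proof (cases "i = n")
      case True
      have "prob {\<omega>\<in>space Q. max m1 m2 < W i \<omega>} \<le> prob {\<omega>\<in>space Q. m2 < W i \<omega>}"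
        by (intro finite_measure_mono) auto
      then show ?thesis using m2 True by simp
    next
      case False
      have "prob {\<omega>\<in>space Q. max m1 m2 < W i \<omega>} \<le> prob {\<omega>\<in>space Q. m1 < W i \<omega>}"
        by (intro finite_measure_mono) auto
      then show ?thesis using m1[of i] that False by simp
    qed
    then show ?case by blast
  qed simp
  then obtain m1 where m1: "\<And>i. i < i0 \<Longrightarrow> prob {\<omega>\<in>space Q. m1 < W i \<omega>} \<le> \<eta>" by blast
  have "prob {\<omega>\<in>space Q. max m1 (m0 + 1) < W i \<omega>} \<le> \<eta>" for i
  proof (cases "i < i0")
    case True
    have "prob {\<omega>\<in>space Q. max m1 (m0 + 1) < W i \<omega>} \<le> prob {\<omega>\<in>space Q. m1 < W i \<omega>}"
      by (intro finite_measure_mono) auto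
    then show ?thesis using m1[OF True] by simp
  next
    case False
    have "prob {\<omega>\<in>space Q. max m1 (m0 + 1) < W i \<omega>} \<le> prob {\<omega>\<in>space Q. m0 + 1 < W i \<omega>}"
      by (intro finite_measure_mono) auto
    then show ?thesis using late[of i] False by simp
  qed
  then show thesis by (rule that)
qed

text \<open>A mixing rate, uniform in the restart time: it bounds the total variation distance
  between the laws of \<open>W (i + d)\<close> and \<open>W d\<close> and, up to a factor 2, the
  correlations in the ergodic theorem.\<close>

definition uncoupled :: "nat \<Rightarrow> real" where
  "uncoupled d = (SUP i. prob {\<omega>\<in>space Q. W (i + d) \<omega> \<noteq> restarted_W i d \<omega>})"

lemma prob_uncoupled_le: "prob {\<omega>\<in>space Q. W (i + d) \<omega> \<noteq> restarted_W i d \<omega>} \<le> uncoupled d"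
  unfolding uncoupled_def by (rule cSUP_upper) (auto intro!: bdd_aboveI[of _ 1])

lemma uncoupled_nonneg: "0 \<le> uncoupled d"
  using prob_uncoupled_le[of 0 d] measure_nonneg order_trans by blast

text \<open>Failure to couple needs \<open>W i > m\<close> or a drift of at most \<open>m\<close>
  over the next \<open>d\<close> symbols. Tightness bounds the first uniformly in \<open>i\<close>,
  and shift invariance makes the probability of the second independent of \<open>i\<close>.\<close>

lemma uncoupled_tendsto_0: "uncoupled \<longlonglongrightarrow> 0"
proof (rule LIMSEQ_I)
  fix \<epsilon> :: real assume \<epsilon>: "0 < \<epsilon>"
  obtain m where m: "\<And>i. prob {\<omega>\<in>space Q. m < W i \<omega>} \<le> \<epsilon> / 4"
    using W_tight[of "\<epsilon> / 4"] \<epsilon> by auto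
  obtain N where N: "\<And>d. d \<ge> N \<Longrightarrow>
      norm (prob {\<omega>\<in>space Q. (\<Sum>k=1..d. \<tau> k \<omega> - S k \<omega>) \<le> m} - 0) < \<epsilon> / 4"
    using LIMSEQ_D[OF drift_tendsto_infinity[of m], of "\<epsilon> / 4"] \<epsilon> by auto
  have "norm (uncoupled d - 0) < \<epsilon>" if d: "d \<ge> N" for d
  proof -
    have "prob {\<omega>\<in>space Q. W (i + d) \<omega> \<noteq> restarted_W i d \<omega>} \<le> \<epsilon> / 2" for i
    proof -
      let ?D = "\<lambda>\<omega>. \<Sum>k=1..d. \<tau> (i + k) \<omega> - S (i + k) \<omega>"
      have D_meas[measurable]: "?D \<in> borel_measurable Q" by measurable
      have D0_meas[measurable]: "(\<lambda>\<omega>. \<Sum>k=1..d. \<tau> k \<omega> - S k \<omega>) \<in> borel_measurable Q" by measurable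
      have "prob {\<omega>\<in>space Q. ?D \<omega> \<le> m} = measure (distr Q borel ?D) {..m}"
        by (subst measure_distr[OF D_meas]) (auto intro!: arg_cong[where f=prob])
      also have "\<dots> = prob {\<omega>\<in>space Q. (\<Sum>k=1..d. \<tau> k \<omega> - S k \<omega>) \<le> m}"
        unfolding distr_drift_shift
        by (subst measure_distr[OF D0_meas]) (auto intro!: arg_cong[where f=prob])
      finally have D: "prob {\<omega>\<in>space Q. ?D \<omega> \<le> m} < \<epsilon> / 4" using N[OF d] by simp
      have "prob {\<omega>\<in>space Q. W (i + d) \<omega> \<noteq> restarted_W i d \<omega>} \<le>
          prob ({\<omega>\<in>space Q. m < W i \<omega>} \<union> {\<omega>\<in>space Q. ?D \<omega> \<le> m})"
      proof (rule finite_measure_mono_AE)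
        show "AE \<omega> in Q. \<omega> \<in> {\<omega>\<in>space Q. W (i + d) \<omega> \<noteq> restarted_W i d \<omega>} \<longrightarrow>
            \<omega> \<in> {\<omega>\<in>space Q. m < W i \<omega>} \<union> {\<omega>\<in>space Q. ?D \<omega> \<le> m}"
          using AE_S_nonneg
        proof eventually_elim
          case (elim \<omega>)
          show ?case
          proof
            assume A: "\<omega> \<in> {\<omega>\<in>space Q. W (i + d) \<omega> \<noteq> restarted_W i d \<omega>}"
            have "?D \<omega> \<le> W i \<omega>" by (rule drift_le_of_not_coupled) (use elim A in auto)
            then show "\<omega> \<in> {\<omega>\<in>space Q. m < W i \<omega>} \<union> {\<omega>\<in>space Q. ?D \<omega> \<le> m}"
              using A by auto
          qed
        qed
      qed measurable
      also have "\<dots> \<le> prob {\<omega>\<in>space Q. m < W i \<omega>} + prob {\<omega>\<in>space Q. ?D \<omega> \<le> m}"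
        by (rule measure_Un_le) measurable
      finally show ?thesis using m[of i] D by linarith
    qed
    \<comment> \<open>A supremum preserves only weak inequalities, hence the target \<epsilon> /
      2.\<close>
    then have "uncoupled d \<le> \<epsilon> / 2" unfolding uncoupled_def by (intro cSUP_least) auto
    then show ?thesis using uncoupled_nonneg[of d] \<epsilon> by simp
  qed
  then show "\<exists>no. \<forall>d\<ge>no. norm (uncoupled d - 0) < \<epsilon>" by blast
qed

lemma expectation_abs_diff_le_uncoupled:
  fixes h :: "real \<Rightarrow> real"
  assumes [measurable]: "h \<in> borel_measurable borel" and range: "\<And>x. 0 \<le> h x \<and> h x \<le> 1"
  shows "expectation (\<lambda>\<omega>. \<bar>h (W (i + d) \<omega>) - h (restarted_W i d \<omega>)\<bar>) \<le> uncoupled d"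
proof -
  let ?A = "{\<omega>\<in>space Q. W (i + d) \<omega> \<noteq> restarted_W i d \<omega>}"
  have "expectation (\<lambda>\<omega>. \<bar>h (W (i + d) \<omega>) - h (restarted_W i d \<omega>)\<bar>) \<le> expectation (indicat_real ?A)"
  proof (intro integral_mono integrable_const_bound[where B=1])
    fix \<omega> assume "\<omega> \<in> space Q"
    then show "\<bar>h (W (i + d) \<omega>) - h (restarted_W i d \<omega>)\<bar> \<le> indicat_real ?A \<omega>"
      using range[of "W (i + d) \<omega>"] range[of "restarted_W i d \<omega>"] by (auto simp: indicator_def)
  next
    show "AE \<omega> in Q. norm \<bar>h (W (i + d) \<omega>) - h (restarted_W i d \<omega>)\<bar> \<le> 1"
      using range by (intro AE_I2) (smt (verit) real_norm_def)
  qed (auto simp: indicator_def)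
  also have "\<dots> = prob ?A" by simp
  finally show ?thesis using prob_uncoupled_le[of i d] by simp
qed

lemma integrable_bounded_W:
  fixes h :: "real \<Rightarrow> real"
  assumes [measurable]: "h \<in> borel_measurable borel" and range: "\<And>x. 0 \<le> h x \<and> h x \<le> 1"
  shows "integrable Q (\<lambda>\<omega>. h (W j \<omega>))" "integrable Q (\<lambda>\<omega>. h (restarted_W i j \<omega>))"
  using range by (auto intro!: integrable_const_bound[where B=1])

lemma expectation_restarted:
  fixes h :: "real \<Rightarrow> real"
  assumes h: "h \<in> borel_measurable borel"
  shows "expectation (\<lambda>\<omega>. h (restarted_W i d \<omega>)) = expectation (\<lambda>\<omega>. h (W d \<omega>))"
proof -
  have "expectation (\<lambda>\<omega>. h (restarted_W i d \<omega>)) = (\<integral>x. h x \<partial>distr Q borel (restarted_W i d))"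
    by (rule integral_distr[symmetric]) (use h in auto)
  also have "\<dots> = expectation (\<lambda>\<omega>. h (W d \<omega>))"
    unfolding distr_W_shift by (rule integral_distr) (use h in auto)
  finally show ?thesis .
qed

text \<open>Coupling inequality: \<open>restarted_W i d\<close> has the law of \<open>W d\<close>
  but lives on the same space as \<open>W (i + d)\<close> and mostly agrees with it.\<close>

lemma total_variation_Cauchy_W: "total_variation_Cauchy \<pi> (\<lambda>j. distr Q borel (W j)) uncoupled"
proof (intro total_variation_Cauchy.intro total_variation_Cauchy_axioms.intro)
  fix h :: "real \<Rightarrow> real" and i d :: nat
  assume h[measurable]: "h \<in> borel_measurable borel" and "\<And>x. 0 \<le> h x \<and> h x \<le> 1"
  note int = integrable_bounded_W[OF this]
    and le = expectation_abs_diff_le_uncoupled[OF this, of i d]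
  have "\<bar>(\<integral>x. h x \<partial>distr Q borel (W (i + d))) - (\<integral>x. h x \<partial>distr Q borel (W d))\<bar> =
      \<bar>expectation (\<lambda>\<omega>. h (W (i + d) \<omega>)) - expectation (\<lambda>\<omega>. h (restarted_W i d \<omega>))\<bar>"
    by (simp add: integral_distr expectation_restarted)
  also have "\<dots> = \<bar>expectation (\<lambda>\<omega>. h (W (i + d) \<omega>) - h (restarted_W i d \<omega>))\<bar>"
    using int by simp
  also have "\<dots> \<le> expectation (\<lambda>\<omega>. \<bar>h (W (i + d) \<omega>) - h (restarted_W i d \<omega>)\<bar>)"
    by (rule integral_abs_bound)
  also note le
  finally show "\<bar>(\<integral>x. h x \<partial>distr Q borel (W (i + d))) - (\<integral>x. h x \<partial>distr Q borel (W d))\<bar> \<le> uncoupled d" .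
qed (use real_distribution_\<pi> real_distribution_W weak_conv_W in auto)

text \<open>Total variation convergence transfers the null set \<open>{..<0}\<close> to the limit.
  This makes the values of \<open>p\<close> at negative arguments irrelevant to the capacity
  formula.\<close>

lemma AE_\<pi>_nonneg: "AE w in \<pi>. 0 \<le> w"
proof -
  interpret TV: total_variation_Cauchy \<pi> "\<lambda>j. distr Q borel (W j)" uncoupled
    by (rule total_variation_Cauchy_W)
  have "measure (distr Q borel (W d)) {..<0} = 0" for d
  proof -
    have "AE \<omega> in Q. \<not> W d \<omega> < 0" using AE_W_nonneg by eventually_elim (auto simp: not_less)
    then have "prob {\<omega>\<in>space Q. W d \<omega> < 0} = 0" by (subst prob_eq_0) auto
    moreover have "measure (distr Q borel (W d)) {..<0} = prob {\<omega>\<in>space Q. W d \<omega> < 0}"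
      by (subst measure_distr) (auto intro!: arg_cong[where f=prob])
    ultimately show ?thesis by simp
  qed
  then have "\<bar>measure \<pi> {..<0}\<bar> \<le> uncoupled d" for d
    using TV.measure_bound[of "{..<0}" d] by simp
  then have "\<bar>measure \<pi> {..<0}\<bar> \<le> 0"
    by (intro LIMSEQ_le_const[OF uncoupled_tendsto_0]) auto
  then have "measure \<pi> {..<0} = 0" by (simp add: measure_le_0_iff)
  then have "TV.prob {x\<in>space \<pi>. x < 0} = 0" by (simp add: lessThan_def)
  then have "AE x in \<pi>. \<not> x < 0" by (subst (asm) TV.prob_eq_0) auto
  then show ?thesis by (simp add: not_less)
qed

theorem ergodic_average_L1:
  fixes h :: "real \<Rightarrow> real"
  assumes h[measurable]: "h \<in> borel_measurable borel" and range: "\<And>x. 0 \<le> h x \<and> h x \<le> 1"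
  shows "(\<lambda>n. expectation (\<lambda>\<omega>. \<bar>(\<Sum>j=1..n. h (W j \<omega>)) / real n - (\<integral>w. h w \<partial>\<pi>)\<bar>)) \<longlonglongrightarrow> 0"
proof -
  interpret TV: total_variation_Cauchy \<pi> "\<lambda>j. distr Q borel (W j)" uncoupled
    by (rule total_variation_Cauchy_W)
  define c where "c = (\<integral>w. h w \<partial>\<pi>)"
  have c: "0 \<le> c" "c \<le> 1"
  proof -
    have i: "integrable \<pi> h" using range by (intro TV.integrable_const_bound[where B=1]) auto
    show "0 \<le> c" unfolding c_def using range by (intro Bochner_Integration.integral_nonneg) auto
    have "c \<le> (\<integral>w. 1 \<partial>\<pi>)" unfolding c_def using range i by (intro integral_mono) auto
    then show "c \<le> 1" using TV.prob_space by simp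
  qed
  \<comment> \<open>Centred at the limit mean and not at the mean of \<open>h (W i)\<close>, which
    varies with \<open>i\<close>; the resulting bias is what \<open>Ek\<close> bounds.\<close>
  define k where "k i \<omega> = h (W i \<omega>) - c" for i \<omega>
  have k_bnd: "\<bar>k i \<omega>\<bar> \<le> 1" for i \<omega>
    using c range[of "W i \<omega>"] unfolding k_def by linarith
  have k_meas[measurable]: "k i \<in> borel_measurable Q" for i unfolding k_def by measurable
  note int = integrable_bounded_W[OF h range]
  have Ek: "\<bar>expectation (k d)\<bar> \<le> uncoupled d" for d
  proof -
    have "expectation (k d) = (\<integral>x. h x \<partial>distr Q borel (W d)) - c"
      using int(1)[of d] by (simp add: k_def[abs_def] integral_distr prob_space)
    then show ?thesis using TV.integral_bound[OF h range, of d]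
      by (simp add: c_def abs_minus_commute)
  qed
  \<comment> \<open>One \<open>uncoupled d\<close> pays for replacing \<open>W (i + d)\<close> by
    the restarted copy, which is independent of \<open>W i\<close>; the other is the bias of the
    second factor in the resulting product of means.\<close>
  have cov: "\<bar>expectation (\<lambda>\<omega>. k i \<omega> * k (i + d) \<omega>)\<bar> \<le> 2 * uncoupled d" for i d
  proof -
    define k' where "k' \<omega> = h (restarted_W i d \<omega>) - c" for \<omega>
    have k'_bnd: "\<bar>k' \<omega>\<bar> \<le> 1" for \<omega>
      using c range[of "restarted_W i d \<omega>"] unfolding k'_def by linarith
    have k'_meas[measurable]: "k' \<in> borel_measurable Q" unfolding k'_def by measurable
    have k_int: "integrable Q (k j)" for j
      using k_bnd by (intro integrable_const_bound[where B=1]) auto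
    have k'_int: "integrable Q k'"
      using k'_bnd by (intro integrable_const_bound[where B=1]) auto
    have mult_bnd: "\<bar>a * b\<bar> \<le> 1" if "\<bar>a\<bar> \<le> 1" "\<bar>b\<bar> \<le> 1" for a b :: real
      using that by (simp add: abs_mult mult_le_one)
    have kk_int: "integrable Q (\<lambda>\<omega>. k i \<omega> * k (i + d) \<omega>)"
      using mult_bnd[OF k_bnd k_bnd] by (intro integrable_const_bound[where B=1]) auto
    have kk'_int: "integrable Q (\<lambda>\<omega>. k i \<omega> * k' \<omega>)"
      using mult_bnd[OF k_bnd k'_bnd] by (intro integrable_const_bound[where B=1]) auto
    have "indep_var borel ((\<lambda>x. h x - c) \<circ> W i) borel ((\<lambda>x. h x - c) \<circ> restarted_W i d)"
      by (rule indep_var_compose[OF indep_W_W_shift]) auto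
    then have "expectation (\<lambda>\<omega>. k i \<omega> * k' \<omega>) = expectation (k i) * expectation k'"
      using k_int k'_int by (intro indep_var_lebesgue_integral) (simp_all add: comp_def k_def[abs_def] k'_def[abs_def])
    also have "expectation k' = expectation (k d)"
      unfolding k_def k'_def by (rule expectation_restarted[of "\<lambda>x. h x - c"]) measurable
    finally have "\<bar>expectation (\<lambda>\<omega>. k i \<omega> * k' \<omega>)\<bar> \<le> 1 * uncoupled d"
    proof -
      assume eq: "expectation (\<lambda>\<omega>. k i \<omega> * k' \<omega>) = expectation (k i) * expectation (k d)"
      have "\<bar>expectation (k i)\<bar> \<le> expectation (\<lambda>\<omega>. \<bar>k i \<omega>\<bar>)" by (rule integral_abs_bound)
      also have "\<dots> \<le> expectation (\<lambda>\<omega>. 1)" using k_int k_bnd by (intro integral_mono) auto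
      finally have "\<bar>expectation (k i)\<bar> \<le> 1" by (simp add: prob_space)
      then show ?thesis unfolding eq abs_mult using Ek[of d] by (intro mult_mono) auto
    qed
    moreover have "\<bar>expectation (\<lambda>\<omega>. k i \<omega> * k (i + d) \<omega>) - expectation (\<lambda>\<omega>. k i \<omega> * k' \<omega>)\<bar> \<le> uncoupled d"
    proof -
      have "\<bar>expectation (\<lambda>\<omega>. k i \<omega> * k (i + d) \<omega>) - expectation (\<lambda>\<omega>. k i \<omega> * k' \<omega>)\<bar> =
          \<bar>expectation (\<lambda>\<omega>. k i \<omega> * k (i + d) \<omega> - k i \<omega> * k' \<omega>)\<bar>"
        using kk_int kk'_int by simp
      also have "\<dots> \<le> expectation (\<lambda>\<omega>. \<bar>k i \<omega> * k (i + d) \<omega> - k i \<omega> * k' \<omega>\<bar>)" by (rule integral_abs_bound)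
      also have "\<dots> \<le> expectation (\<lambda>\<omega>. \<bar>h (W (i + d) \<omega>) - h (restarted_W i d \<omega>)\<bar>)"
      proof (rule integral_mono)
        show "integrable Q (\<lambda>\<omega>. \<bar>k i \<omega> * k (i + d) \<omega> - k i \<omega> * k' \<omega>\<bar>)" using kk_int kk'_int by auto
        show "integrable Q (\<lambda>\<omega>. \<bar>h (W (i + d) \<omega>) - h (restarted_W i d \<omega>)\<bar>)" using int by auto
        fix \<omega>
        have "k i \<omega> * k (i + d) \<omega> - k i \<omega> * k' \<omega> = k i \<omega> * (h (W (i + d) \<omega>) - h (restarted_W i d \<omega>))"
          by (simp add: k_def k'_def algebra_simps)
        then show "\<bar>k i \<omega> * k (i + d) \<omega> - k i \<omega> * k' \<omega>\<bar> \<le> \<bar>h (W (i + d) \<omega>) - h (restarted_W i d \<omega>)\<bar>"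
          using mult_right_mono[OF k_bnd[of i \<omega>], of "\<bar>h (W (i + d) \<omega>) - h (restarted_W i d \<omega>)\<bar>"]
          by (simp add: abs_mult)
      qed
      also have "\<dots> \<le> uncoupled d" by (rule expectation_abs_diff_le_uncoupled[OF h range])
      finally show ?thesis .
    qed
    ultimately show ?thesis by linarith
  qed
  have "(\<lambda>n. expectation (\<lambda>\<omega>. \<bar>(\<Sum>i=1..n. k i \<omega>) / real n\<bar>)) \<longlonglongrightarrow> 0"
  proof (rule average_tendsto_0_L1[where \<rho>="\<lambda>d. 2 * uncoupled d" and B=1])
    show "\<bar>expectation (\<lambda>\<omega>. k i \<omega> * k j \<omega>)\<bar> \<le> 2 * uncoupled (j - i)" if "i < j" for i j
      using cov[of i "j - i"] that by simp
    show "(\<lambda>d. 2 * uncoupled d) \<longlonglongrightarrow> 0" using tendsto_mult_right_zero[OF uncoupled_tendsto_0] .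
  qed (use k_bnd in auto)
  then show ?thesis
  proof (rule Lim_transform_eventually)
    show "\<forall>\<^sub>F n in sequentially. expectation (\<lambda>\<omega>. \<bar>(\<Sum>i=1..n. k i \<omega>) / real n\<bar>) =
        expectation (\<lambda>\<omega>. \<bar>(\<Sum>j=1..n. h (W j \<omega>)) / real n - (\<integral>w. h w \<partial>\<pi>)\<bar>)"
      \<comment> \<open>At \<open>n = 0\<close> the two sides differ: division by zero gives 0 on
        the left, but \<open>c\<close> is still subtracted on the right.\<close>
      using eventually_gt_at_top[of 0]
    proof eventually_elim
      case (elim n)
      have "(\<Sum>i=1..n. k i \<omega>) / real n = (\<Sum>j=1..n. h (W j \<omega>)) / real n - (\<integral>w. h w \<partial>\<pi>)" for \<omega>
        using elim by (simp add: k_def c_def sum_subtractf field_simps)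
      then show ?case by simp
    qed
  qed
qed

section \<open>Sublinear growth of the mean sojourn time\<close>

lemma AE_W_le_sum: "AE \<omega> in Q. \<forall>n. W n \<omega> \<le> (\<Sum>k=1..n. S k \<omega>)"
  using AE_S_nonneg AE_\<tau>_nonneg
proof eventually_elim
  case (elim \<omega>)
  have "W n \<omega> \<le> (\<Sum>k=1..n. S k \<omega>)" for n
  proof (induction n)
    case (Suc n)
    have "0 \<le> W n \<omega>" using elim by (intro sojourn_time_nonneg) auto
    moreover have "0 \<le> \<tau> (Suc n) \<omega>" using elim by auto
    ultimately show ?case using Suc by (simp add: sojourn_time_Suc)
  qed simp
  then show ?case by simp
qed

lemma integrable_W: "integrable Q (W n)"
proof (rule Bochner_Integration.integrable_bound)
  show "integrable Q (\<lambda>\<omega>. \<Sum>k=1..n. S k \<omega>)" using service_integrable by auto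
  show "AE \<omega> in Q. norm (W n \<omega>) \<le> norm (\<Sum>k=1..n. S k \<omega>)"
    using AE_W_le_sum AE_W_nonneg by eventually_elim (auto intro: order_trans[OF _ abs_ge_self])
qed simp

lemma expectation_W_nonneg: "0 \<le> expectation (W n)"
  using AE_W_nonneg by (intro integral_nonneg_AE) auto

lemma expectation_departure_time:
  "expectation (departure_time \<tau> S n) = real n / lam + expectation (W n)"
proof -
  have A: "arrival_time \<tau> n = (\<lambda>\<omega>. \<Sum>i=1..n. \<tau> i \<omega>)" by (simp add: arrival_time_def[abs_def])
  have "departure_time \<tau> S n = (\<lambda>\<omega>. arrival_time \<tau> n \<omega> + W n \<omega>)"
    by (simp add: sojourn_time_def)
  moreover have "integrable Q (arrival_time \<tau> n)"
    unfolding A using integrable_\<tau> by auto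
  moreover have "expectation (arrival_time \<tau> n) = real n / lam"
  proof -
    have "expectation (arrival_time \<tau> n) = (\<Sum>i=1..n. expectation (\<tau> i))"
      unfolding A using integrable_\<tau> by (intro Bochner_Integration.integral_sum) auto
    also have "\<dots> = (\<Sum>i=1..n. 1 / lam)" using expectation_\<tau> by (intro sum.cong) auto
    finally show ?thesis by simp
  qed
  ultimately show ?thesis using integrable_W[of n] by simp
qed

lemma average_service_L1: "(\<lambda>n. expectation (\<lambda>\<omega>. \<bar>(\<Sum>k=1..n. S k \<omega>) / real n - 1\<bar>)) \<longlonglongrightarrow> 0"
proof -
  have indep: "indep_var borel (S i) borel (S j)" if "1 \<le> i" "i < j" for i j
    using indep_vars_imp_indep_var[OF independent InrI InrI, of i j] that by simp
  have "(\<lambda>n. expectation (\<lambda>\<omega>. \<bar>(\<Sum>k=1..n. S k \<omega>) / real n - expectation (S 1)\<bar>)) \<longlonglongrightarrow> 0"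
    using indep distr_S service_integrable[of 1] by (rule weak_law_of_large_numbers_L1) auto
  then show ?thesis using service_mean[of 1] by simp
qed

text \<open>
  No second moment of the service times is assumed, so \<open>W\<close> need not be bounded in mean; the bound
  \<open>W n \<le> S 1 + \<dots> + S n\<close> makes \<open>W n / n\<close> uniformly integrable, and tightness does the rest.
\<close>

lemma expectation_W_sublinear: "(\<lambda>n. expectation (W n) / real n) \<longlonglongrightarrow> 0"
proof (rule LIMSEQ_I)
  fix \<epsilon> :: real assume \<epsilon>: "0 < \<epsilon>"
  obtain m where m: "\<And>i. prob {\<omega>\<in>space Q. m < W i \<omega>} \<le> \<epsilon> / 4" using W_tight[of "\<epsilon> / 4"] \<epsilon> by auto
  obtain N where N: "\<And>n. n \<ge> N \<Longrightarrow> expectation (\<lambda>\<omega>. \<bar>(\<Sum>k=1..n. S k \<omega>) / real n - 1\<bar>) < \<epsilon> / 4"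
  proof -
    from order_tendstoD(2)[OF average_service_L1, of "\<epsilon> / 4"] \<epsilon> show thesis
      using that by (auto simp: eventually_sequentially)
  qed
  obtain N' :: nat where N': "4 * \<bar>m\<bar> / \<epsilon> < real N'" using reals_Archimedean2 by blast
  have "norm (expectation (W n) / real n - 0) < \<epsilon>" if n: "n \<ge> max (max N N') 1" for n
  proof -
    let ?A = "{\<omega>\<in>space Q. m < W n \<omega>}"
    have mn: "\<bar>m\<bar> / real n \<le> \<epsilon> / 4"
    proof -
      have "4 * \<bar>m\<bar> / \<epsilon> < real n" using N' n by (meson less_le_trans max.boundedE of_nat_le_iff)
      then show ?thesis using \<epsilon> n by (simp add: field_simps)
    qed
    have i1: "integrable Q (\<lambda>\<omega>. \<bar>(\<Sum>k=1..n. S k \<omega>) / real n - 1\<bar>)"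
      using service_integrable
      by (intro integrable_abs Bochner_Integration.integrable_diff integrable_divide
          Bochner_Integration.integrable_sum) auto
    have i2: "integrable Q (indicat_real ?A)" by (intro integrable_const_bound[where B=1]) auto
    \<comment> \<open>On \<open>?A\<close> the average service time is bounded by its distance to 1
      plus 1, and the indicator supplies that 1. Off \<open>?A\<close> the sojourn time is at most
      \<open>m\<close>.\<close>
    have "expectation (\<lambda>\<omega>. W n \<omega> / real n) \<le>
        expectation (\<lambda>\<omega>. \<bar>(\<Sum>k=1..n. S k \<omega>) / real n - 1\<bar> + \<epsilon> / 4 + indicat_real ?A \<omega>)"
    proof (rule integral_mono_AE)
      show "AE \<omega> in Q. W n \<omega> / real n \<le>
          \<bar>(\<Sum>k=1..n. S k \<omega>) / real n - 1\<bar> + \<epsilon> / 4 + indicat_real ?A \<omega>"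
        using AE_W_le_sum AE_space
      proof eventually_elim
        case (elim \<omega>)
        show ?case
        proof (cases "\<omega> \<in> ?A")
          case True
          have "W n \<omega> / real n \<le> (\<Sum>k=1..n. S k \<omega>) / real n"
            using elim by (intro divide_right_mono) auto
          then show ?thesis using True \<epsilon> by (simp add: indicator_def)
        next
          case False
          have "W n \<omega> / real n \<le> \<bar>m\<bar> / real n"
            using elim False by (intro divide_right_mono) auto
          moreover have "indicat_real ?A \<omega> = 0" using False by simp
          ultimately show ?thesis using mn by linarith
        qed
      qed
    qed (use integrable_W i1 i2 in auto)
    also have "\<dots> = expectation (\<lambda>\<omega>. \<bar>(\<Sum>k=1..n. S k \<omega>) / real n - 1\<bar>) + \<epsilon> / 4 + prob ?A"
      using i1 i2 by (simp add: prob_space)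
    also have "\<dots> < \<epsilon>" using m[of n] N[of n] n \<epsilon> by linarith
    finally show ?thesis using expectation_W_nonneg[of n] by simp
  qed
  then show "\<exists>no. \<forall>n\<ge>no. norm (expectation (W n) / real n - 0) < \<epsilon>" by blast
qed

end

section \<open>Erasure patterns\<close>

text \<open>Since the parameter is clamped anyway, \<open>p\<close> may be replaced by a function
  with values in \<open>[0, 1]\<close> on the whole line without changing the channel. Negative
  sojourn times, possible on a null set, then need no special care.\<close>

lemma bernoulli_pmf_clamp: "bernoulli_pmf (min 1 (max 0 r)) = bernoulli_pmf r"
  by (rule pmf_eqI) (simp add: bernoulli_pmf.rep_eq)

lemma channel_word_clamp: "channel_word (\<lambda>w. min 1 (max 0 (p w))) = channel_word p"
  by (simp add: fun_eq_iff channel_word_def erasure_channel_def bernoulli_pmf_clamp)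

text \<open>\<open>True\<close> marks an erasure. The channel splits into this random pattern, whose
  law ignores the codeword, and the deterministic map \<open>erase\<close>.\<close>

definition erasure_pattern :: "(real \<Rightarrow> real) \<Rightarrow> nat \<Rightarrow> (nat \<Rightarrow> real) \<Rightarrow> (nat \<Rightarrow> bool) pmf" where
  "erasure_pattern p n w = Pi_pmf {1..n} False (\<lambda>j. bernoulli_pmf (p (w j)))"

text \<open>One finite set that carries the pattern law for all sojourn times, so that expectations
  over patterns are finite sums which commute with the integral over the queue.\<close>

definition patterns :: "nat \<Rightarrow> (nat \<Rightarrow> bool) set" where
  "patterns n = PiE_dflt {1..n} False (\<lambda>_. UNIV)"

definition received :: "nat \<Rightarrow> (nat \<Rightarrow> bool) \<Rightarrow> nat set" where
  "received n e = {j\<in>{1..n}. \<not> e j}"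

text \<open>The value \<open>undefined\<close> outside \<open>{1..n}\<close> matches the default of
  \<open>channel_word\<close>.\<close>

definition erase :: "nat \<Rightarrow> (nat \<Rightarrow> bool) \<Rightarrow> (nat \<Rightarrow> 'x) \<Rightarrow> nat \<Rightarrow> 'x option" where
  "erase n e x = (\<lambda>j. if j \<in> {1..n} then if e j then None else Some (x j) else undefined)"

lemma finite_patterns [simp]: "finite (patterns n)"
  unfolding patterns_def by (rule finite_PiE_dflt) auto

lemma finite_received [simp]: "finite (received n e)"
  by (simp add: received_def)

lemma received_subset: "received n e \<subseteq> {1..n}"
  by (auto simp: received_def)

lemma set_pmf_erasure_pattern: "set_pmf (erasure_pattern p n w) \<subseteq> patterns n"
  unfolding erasure_pattern_def patterns_def
  using set_Pi_pmf_subset[of "{1..n}" False "\<lambda>j. bernoulli_pmf (p (w j))"]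
  by (auto simp: PiE_dflt_def)

lemma channel_word_eq_map:
  "channel_word p n x w = map_pmf (\<lambda>e. erase n e x) (erasure_pattern p n w)"
proof -
  have "channel_word p n x w = Pi_pmf {1..n} undefined
      (\<lambda>j. bind_pmf (bernoulli_pmf (p (w j))) (\<lambda>e. return_pmf (if e then None else Some (x j))))"
    by (simp add: channel_word_def erasure_channel_def map_pmf_def)
  also have "\<dots> = bind_pmf (erasure_pattern p n w)
      (\<lambda>e. Pi_pmf {1..n} undefined (\<lambda>j. return_pmf (if e j then None else Some (x j))))"
    unfolding erasure_pattern_def by (rule Pi_pmf_bind) simp
  also have "\<dots> = map_pmf (\<lambda>e. erase n e x) (erasure_pattern p n w)"
    unfolding map_pmf_def erase_def by (subst Pi_pmf_return_pmf) simp_all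
  finally show ?thesis .
qed

lemma expectation_pattern:
  fixes \<phi> :: "(nat \<Rightarrow> bool) \<Rightarrow> real"
  shows "measure_pmf.expectation (erasure_pattern p n w) \<phi> =
    (\<Sum>e\<in>patterns n. pmf (erasure_pattern p n w) e * \<phi> e)"
  using set_pmf_erasure_pattern by (subst integral_measure_pmf[where A="patterns n"]) auto

lemma prob_channel_word:
  "measure_pmf.prob (channel_word p n x w) {y. B y} =
    (\<Sum>e\<in>patterns n. pmf (erasure_pattern p n w) e * of_bool (B (erase n e x)))"
proof -
  have "measure_pmf.prob (channel_word p n x w) {y. B y} =
      measure_pmf.prob (erasure_pattern p n w) {e. B (erase n e x)}"
    by (simp add: channel_word_eq_map vimage_def)
  also have "\<dots> = measure_pmf.expectation (erasure_pattern p n w) (indicat_real {e. B (erase n e x)})"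
    by simp
  also have "indicat_real {e. B (erase n e x)} = (\<lambda>e. of_bool (B (erase n e x)))"
    by (auto simp: indicator_def)
  finally show ?thesis by (simp add: expectation_pattern)
qed

lemma sum_pmf_pattern: "(\<Sum>e\<in>patterns n. pmf (erasure_pattern p n w) e) = 1"
  using expectation_pattern[of p n w "\<lambda>_. 1"] by simp

context
  fixes p :: "real \<Rightarrow> real"
  assumes p_range: "\<And>w. 0 \<le> p w \<and> p w \<le> 1"
begin

lemma pmf_erasure_pattern:
  "e \<in> patterns n \<Longrightarrow>
    pmf (erasure_pattern p n w) e = (\<Prod>j\<in>{1..n}. if e j then p (w j) else 1 - p (w j))"
  unfolding erasure_pattern_def patterns_def
  using p_range by (subst pmf_Pi') (auto simp: PiE_dflt_def intro!: prod.cong)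

lemma expectation_card_received:
  "(\<Sum>e\<in>patterns n. pmf (erasure_pattern p n w) e * real (card (received n e))) =
    (\<Sum>j=1..n. 1 - p (w j))"
proof -
  have card: "real (card (received n e)) = (\<Sum>j\<in>{1..n}. if e j then 0 else 1)" for e
    by (simp add: received_def sum.If_cases Int_def)
  have "(\<Sum>e\<in>patterns n. pmf (erasure_pattern p n w) e * real (card (received n e))) =
      measure_pmf.expectation (erasure_pattern p n w) (\<lambda>e. \<Sum>j\<in>{1..n}. if e j then 0 else 1)"
    by (simp only: card expectation_pattern)
  also have "\<dots> = (\<Sum>j\<in>{1..n}. measure_pmf.expectation (bernoulli_pmf (p (w j))) (\<lambda>b. if b then 0 else 1))"
  proof -
    have fin: "finite (set_pmf (erasure_pattern p n w))"
      using set_pmf_erasure_pattern finite_patterns by (rule finite_subset)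
    have "measure_pmf.expectation (erasure_pattern p n w) (\<lambda>e. \<Sum>j\<in>{1..n}. if e j then 0 else 1) =
        (\<Sum>j\<in>{1..n}. measure_pmf.expectation (erasure_pattern p n w) (\<lambda>e. if e j then 0 else 1 :: real))"
      using fin by (intro Bochner_Integration.integral_sum integrable_measure_pmf_finite)
    also have "\<dots> = (\<Sum>j\<in>{1..n}. measure_pmf.expectation
        (map_pmf (\<lambda>e. e j) (erasure_pattern p n w)) (\<lambda>b. if b then 0 else 1))"
      by simp
    also have "\<dots> = (\<Sum>j\<in>{1..n}. measure_pmf.expectation (bernoulli_pmf (p (w j))) (\<lambda>b. if b then 0 else 1))"
      unfolding erasure_pattern_def by (intro sum.cong refl, subst Pi_pmf_component) auto
    finally show ?thesis .
  qed
  also have "\<dots> = (\<Sum>j=1..n. 1 - p (w j))" using p_range by simp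
  finally show ?thesis .
qed

text \<open>The probability generating function of the number of received symbols; given the sojourn
  times, the erasures are independent.\<close>

lemma expectation_power_received:
  fixes a :: real
  assumes a: "0 \<le> a"
  shows "(\<Sum>e\<in>patterns n. pmf (erasure_pattern p n w) e * a ^ card (received n e)) =
    (\<Prod>j=1..n. p (w j) + (1 - p (w j)) * a)"
proof -
  have card: "a ^ card (received n e) = (\<Prod>j\<in>{1..n}. if e j then 1 else a)" for e
    by (simp add: received_def prod.If_cases Int_def)
  have "(\<Sum>e\<in>patterns n. pmf (erasure_pattern p n w) e * a ^ card (received n e)) =
      measure_pmf.expectation (erasure_pattern p n w) (\<lambda>e. \<Prod>j\<in>{1..n}. if e j then 1 else a)"
    by (simp only: card expectation_pattern)
  also have "\<dots> = (\<Prod>j\<in>{1..n}. measure_pmf.expectation (bernoulli_pmf (p (w j))) (\<lambda>b. if b then 1 else a))"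
    unfolding erasure_pattern_def
    by (rule expectation_prod_Pi_pmf) (use a in \<open>auto intro: integrable_measure_pmf_finite\<close>)
  also have "\<dots> = (\<Prod>j=1..n. p (w j) + (1 - p (w j)) * a)" using p_range by (simp add: mult.commute)
  finally show ?thesis .
qed

end

section \<open>Converse\<close>

lemma less_two_powr: "d \<le> 2 powr d" if "0 \<le> d" for d :: real
proof -
  have "nat \<lfloor>d\<rfloor> < 2 ^ nat \<lfloor>d\<rfloor>" by (rule less_exp)
  then have "nat \<lfloor>d\<rfloor> + 1 \<le> 2 ^ nat \<lfloor>d\<rfloor>" by (simp only: Suc_eq_plus1[symmetric] Suc_le_eq)
  then have "real (nat \<lfloor>d\<rfloor> + 1) \<le> 2 ^ nat \<lfloor>d\<rfloor>"
    by (metis of_nat_le_iff of_nat_numeral of_nat_power)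
  then have "d \<le> 2 ^ nat \<lfloor>d\<rfloor>" using that by linarith
  also have "(2::real) ^ nat \<lfloor>d\<rfloor> = 2 powr real (nat \<lfloor>d\<rfloor>)" by (simp add: powr_realpow)
  also have "\<dots> \<le> 2 powr d" using that by (intro powr_mono) auto
  finally show ?thesis .
qed

text \<open>Plays the part of Fano's inequality: with \<open>2 powr L\<close> messages and
  \<open>x\<close> received bits, the fraction decoded correctly is at most
  \<open>(x + 1) / L\<close>. This is affine in \<open>x\<close>, so averaging over patterns needs
  only the mean of \<open>x\<close>. The case \<open>x < L\<close> reduces to
  \<open>d \<le> 2 powr d\<close> for \<open>d = L - x\<close>.\<close>

lemma mult_min_powr_le:
  fixes L x :: real
  assumes "0 \<le> L" "0 \<le> x"
  shows "L * min (2 powr L) (2 powr x) \<le> 2 powr L * (x + 1)"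
proof (cases "L \<le> x")
  case True
  then have "min (2 powr L) (2 powr x) = 2 powr L" by (simp add: min_def)
  then show ?thesis using True by (simp add: mult.commute mult_left_mono)
next
  case False
  define d where "d = L - x"
  have d: "0 \<le> d" "L = x + d" using False by (auto simp: d_def)
  have "1 \<le> 2 powr d" using d by (simp add: ge_one_powr_ge_zero)
  then have "x * 1 \<le> x * 2 powr d" using assms by (intro mult_left_mono) auto
  then have "x + d \<le> 2 powr d * (x + 1)" using less_two_powr[OF d(1)] by (simp add: algebra_simps)
  then have "2 powr x * (x + d) \<le> 2 powr x * (2 powr d * (x + 1))" by (intro mult_left_mono) auto
  moreover have "min (2 powr L) (2 powr x) = 2 powr x" using d by (simp add: min_def)
  ultimately show ?thesis by (simp add: d(2) powr_add mult_ac)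
qed

text \<open>With the pattern and the decoding map fixed, the output depends on the codeword only at
  the received positions, so two correctly decoded messages must differ there.\<close>

lemma card_correctly_decoded:
  fixes f :: "nat \<Rightarrow> nat \<Rightarrow> 'x" and G :: "(nat \<Rightarrow> 'x option) \<Rightarrow> nat"
  assumes X: "finite X" and f: "encoder X n m f"
  shows "card {i\<in>{..<m}. G (erase n e (f i)) = i} \<le> card X ^ card (received n e)"
proof -
  let ?C = "{i\<in>{..<m}. G (erase n e (f i)) = i}" and ?R = "received n e"
  have "inj_on (\<lambda>i. restrict (f i) ?R) ?C"
  proof (rule inj_onI)
    fix i i' assume i: "i \<in> ?C" "i' \<in> ?C" and eq: "restrict (f i) ?R = restrict (f i') ?R"
    have "erase n e (f i) = erase n e (f i')"
    proof (rule ext)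
      fix j show "erase n e (f i) j = erase n e (f i') j"
        using fun_cong[OF eq, of j] by (auto simp: erase_def received_def restrict_def)
    qed
    then show "i = i'" using i by (metis (mono_tags, lifting) mem_Collect_eq)
  qed
  moreover have "(\<lambda>i. restrict (f i) ?R) ` ?C \<subseteq> (?R \<rightarrow>\<^sub>E X)"
    using f received_subset[of n e] by (fastforce simp: encoder_def PiE_iff)
  moreover have "finite (?R \<rightarrow>\<^sub>E X)" using X by (intro finite_PiE) auto
  ultimately have "card ?C \<le> card (?R \<rightarrow>\<^sub>E X)" by (rule card_inj_on_le)
  then show ?thesis by (simp add: card_PiE)
qed

text \<open>The counting bound, made affine and averaged over the patterns. It is multiplied through
  by \<open>m\<close> and \<open>log 2 m\<close> so that the one-message code, with
  \<open>log 2 m = 0\<close>, needs no separate treatment.\<close>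

lemma sum_error_ge:
  fixes f :: "nat \<Rightarrow> nat \<Rightarrow> 'x" and G :: "(nat \<Rightarrow> 'x option) \<Rightarrow> nat"
  assumes X: "finite X" "X \<noteq> {}" and f: "encoder X n m f" and m: "0 < m"
    and p: "\<And>w. 0 \<le> p w \<and> p w \<le> 1"
  shows "real m * (log 2 m - log 2 (card X) * (\<Sum>j=1..n. 1 - p (w j)) - 1) \<le>
    log 2 m * (\<Sum>i<m. measure_pmf.prob (channel_word p n (f i) w) {y. G y \<noteq> i})"
proof -
  let ?P = "erasure_pattern p n w" and ?L = "log 2 (real m)" and ?l = "log 2 (real (card X))"
  have k: "1 \<le> card X" using X by (simp add: Suc_leI card_gt_0_iff)
  have L: "0 \<le> ?L" and l: "0 \<le> ?l" using m k by auto
  have "(\<Sum>i<m. of_bool (G (erase n e (f i)) \<noteq> i)) =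
      real m - real (card {i\<in>{..<m}. G (erase n e (f i)) = i})" for e
  proof -
    have "(\<Sum>i<m. of_bool (G (erase n e (f i)) \<noteq> i) :: real) =
        (\<Sum>i<m. 1 - of_bool (G (erase n e (f i)) = i))" by (intro sum.cong) auto
    also have "\<dots> = real m - (\<Sum>i<m. of_bool (G (erase n e (f i)) = i))" by (simp add: sum_subtractf)
    also have "(\<Sum>i<m. of_bool (G (erase n e (f i)) = i)) =
        real (card {i\<in>{..<m}. G (erase n e (f i)) = i})"
      by (simp add: of_bool_def sum.If_cases Int_def)
    finally show ?thesis .
  qed
  then have le: "real m * (?L - ?l * real (card (received n e)) - 1) \<le>
      ?L * (\<Sum>i<m. of_bool (G (erase n e (f i)) \<noteq> i))" for e
  proof -
    let ?c = "real (card {i\<in>{..<m}. G (erase n e (f i)) = i})" and ?x = "?l * real (card (received n e))"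
    assume eq: "\<And>e. (\<Sum>i<m. of_bool (G (erase n e (f i)) \<noteq> i)) =
      real m - real (card {i\<in>{..<m}. G (erase n e (f i)) = i})"
    have m_eq: "2 powr ?L = real m" using m by simp
    have k_eq: "2 powr ?x = real (card X) ^ card (received n e)"
      using k by (simp add: powr_powr[symmetric] powr_realpow)
    have "?c \<le> real m"
      using card_mono[of "{..<m}" "{i\<in>{..<m}. G (erase n e (f i)) = i}"] by auto
    moreover have "?c \<le> real (card X) ^ card (received n e)"
      using card_correctly_decoded[OF X(1) f, of G e] by (metis of_nat_le_iff of_nat_power)
    ultimately have "?L * ?c \<le> ?L * min (2 powr ?L) (2 powr ?x)"
      unfolding m_eq k_eq using L by (intro mult_left_mono) auto
    also have "\<dots> \<le> real m * (?x + 1)"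
      using mult_min_powr_le[OF L, of ?x] l by (simp add: m_eq)
    finally show ?thesis unfolding eq by (simp add: algebra_simps)
  qed
  have "real m * (?L - ?l * (\<Sum>j=1..n. 1 - p (w j)) - 1) =
      (\<Sum>e\<in>patterns n. pmf ?P e * (real m * (?L - ?l * real (card (received n e)) - 1)))"
  proof -
    have "(\<Sum>e\<in>patterns n. pmf ?P e * (real m * (?L - ?l * real (card (received n e)) - 1))) =
        (\<Sum>e\<in>patterns n. real m * (?L - 1) * pmf ?P e -
          real m * ?l * (pmf ?P e * real (card (received n e))))"
      by (intro sum.cong) (auto simp: algebra_simps)
    also have "\<dots> = real m * (?L - 1) * (\<Sum>e\<in>patterns n. pmf ?P e) -
        real m * ?l * (\<Sum>e\<in>patterns n. pmf ?P e * real (card (received n e)))"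
      by (simp only: sum_subtractf sum_distrib_left)
    also have "\<dots> = real m * (?L - ?l * (\<Sum>j=1..n. 1 - p (w j)) - 1)"
      unfolding sum_pmf_pattern expectation_card_received[OF p] by (simp only: algebra_simps)
    finally show ?thesis by simp
  qed
  also have "\<dots> \<le> (\<Sum>e\<in>patterns n. pmf ?P e * (?L * (\<Sum>i<m. of_bool (G (erase n e (f i)) \<noteq> i))))"
    using le by (intro sum_mono mult_left_mono) auto
  also have "\<dots> = ?L * (\<Sum>i<m. \<Sum>e\<in>patterns n. pmf ?P e * of_bool (G (erase n e (f i)) \<noteq> i))"
    by (subst sum.swap) (simp add: sum_distrib_left mult_ac)
  also have "\<dots> = ?L * (\<Sum>i<m. measure_pmf.prob (channel_word p n (f i) w) {y. G y \<noteq> i})"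
    by (simp only: prob_channel_word)
  finally show ?thesis .
qed

section \<open>Random coding\<close>

lemma card_agreeing_words:
  assumes X: "finite X" and R: "R \<subseteq> {1..n}"
  shows "card {y \<in> {1..n} \<rightarrow>\<^sub>E X. \<forall>j\<in>R. y j = z j} \<le> card X ^ (n - card R)"
proof -
  let ?B = "\<lambda>j. if j \<in> R then {z j} else X"
  have "{y \<in> {1..n} \<rightarrow>\<^sub>E X. \<forall>j\<in>R. y j = z j} \<subseteq> (\<Pi>\<^sub>E j\<in>{1..n}. ?B j)"
    by (auto simp: PiE_iff extensional_def)
  then have "card {y \<in> {1..n} \<rightarrow>\<^sub>E X. \<forall>j\<in>R. y j = z j} \<le> card (\<Pi>\<^sub>E j\<in>{1..n}. ?B j)"
    using X by (intro card_mono finite_PiE) auto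
  also have "\<dots> = (\<Prod>j\<in>{1..n}. if j \<in> R then 1 else card X)"
    by (simp add: card_PiE if_distrib cong: if_cong)
  also have "\<dots> = card X ^ card ({1..n} - R)"
    by (simp add: prod.If_cases Diff_eq)
  also have "card ({1..n} - R) = n - card R"
    using R by (simp add: card_Diff_subset finite_subset)
  finally show ?thesis .
qed

text \<open>Random coding by counting: a uniformly random codebook is represented by the finite set
  of all codebooks, and averages over it are sums.\<close>

definition codebooks :: "'x set \<Rightarrow> nat \<Rightarrow> nat \<Rightarrow> (nat \<Rightarrow> nat \<Rightarrow> 'x) set" where
  "codebooks X n m = {..<m} \<rightarrow>\<^sub>E ({1..n} \<rightarrow>\<^sub>E X)"

lemma finite_codebooks: "finite X \<Longrightarrow> finite (codebooks X n m)"
  unfolding codebooks_def by (intro finite_PiE) auto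

lemma codebooks_nonempty: "X \<noteq> {} \<Longrightarrow> codebooks X n m \<noteq> {}"
  by (simp add: codebooks_def PiE_eq_empty_iff)

lemma encoder_codebooks: "f \<in> codebooks X n m \<Longrightarrow> encoder X n m f"
  unfolding codebooks_def encoder_def by blast

text \<open>Counting form of the fact that two independent uniform codewords agree on
  \<open>R\<close> with probability \<open>|X| ^ (- card R)\<close>, multiplied out to stay within
  the natural numbers.\<close>

lemma card_agreeing_codebooks:
  assumes X: "finite X" and R: "R \<subseteq> {1..n}" and i: "i < m" "i' < m" "i \<noteq> i'"
  shows "card {f \<in> codebooks X n m. \<forall>j\<in>R. f i' j = f i j} * card X ^ card R \<le> card (codebooks X n m)"
proof -
  let ?A = "{..<m} - {i'}" and ?T = "{1..n} \<rightarrow>\<^sub>E X" and ?k = "card X"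
  let ?F = "{f \<in> codebooks X n m. \<forall>j\<in>R. f i' j = f i j}"
  \<comment> \<open>All codewords except the one of \<open>i'\<close> are chosen first; agreement
    with codeword \<open>i\<close> then fixes codeword \<open>i'\<close> on
    \<open>R\<close>.\<close>
  let ?S = "SIGMA g : (?A \<rightarrow>\<^sub>E ?T). {y \<in> ?T. \<forall>j\<in>R. y j = g i j}"
  have T: "finite ?T" using X by (intro finite_PiE) auto
  have finA: "finite (?A \<rightarrow>\<^sub>E ?T)" by (rule finite_PiE) (use T in auto)
  have "inj_on (\<lambda>f. (restrict f ?A, f i')) ?F"
  proof (rule inj_onI)
    fix f f' assume f: "f \<in> ?F" "f' \<in> ?F" and eq: "(restrict f ?A, f i') = (restrict f' ?A, f' i')"
    show "f = f'"
    proof (rule ext)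
      fix a
      consider "a \<in> ?A" | "a = i'" | "a \<notin> {..<m}" using i by auto
      then show "f a = f' a"
      proof cases
        case 1
        then show ?thesis using eq by (metis prod.inject restrict_apply')
      next
        case 3
        then show ?thesis using f by (auto simp: codebooks_def PiE_iff extensional_def)
      qed (use eq in auto)
    qed
  qed
  moreover have "(\<lambda>f. (restrict f ?A, f i')) ` ?F \<subseteq> ?S"
  proof (rule image_subsetI)
    fix f assume f: "f \<in> ?F"
    then have fT: "f a \<in> ?T" if "a < m" for a
      using that by (auto simp only: codebooks_def PiE_iff mem_Collect_eq lessThan_iff)
    then have "restrict f ?A \<in> ?A \<rightarrow>\<^sub>E ?T" by (simp only: restrict_PiE_iff) auto
    moreover have "f i' \<in> {y \<in> ?T. \<forall>j\<in>R. y j = restrict f ?A i j}"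
      using fT[OF i(2)] f i by simp
    ultimately show "(restrict f ?A, f i') \<in> ?S" unfolding mem_Sigma_iff by (rule conjI)
  qed
  moreover have "finite ?S" using finA T by (intro finite_SigmaI) auto
  ultimately have "card ?F \<le> card ?S" by (rule card_inj_on_le)
  also have "card ?S = (\<Sum>g\<in>?A \<rightarrow>\<^sub>E ?T. card {y \<in> ?T. \<forall>j\<in>R. y j = g i j})"
    using finA T by (intro card_SigmaI) auto
  also have "\<dots> \<le> (\<Sum>g\<in>?A \<rightarrow>\<^sub>E ?T. ?k ^ (n - card R))"
    by (intro sum_mono card_agreeing_words X R)
  finally have "card ?F * ?k ^ card R \<le> card (?A \<rightarrow>\<^sub>E ?T) * ?k ^ (n - card R) * ?k ^ card R"
    by (intro mult_right_mono) auto
  also have "\<dots> = card (?A \<rightarrow>\<^sub>E ?T) * ?k ^ n"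
  proof -
    have "card R \<le> n" using card_mono[OF _ R] by simp
    then show ?thesis by (simp add: mult.assoc flip: power_add)
  qed
  also have "\<dots> = card (codebooks X n m)"
  proof -
    have "(\<Prod>a<m. ?k ^ n) = ?k ^ n * (\<Prod>a\<in>?A. ?k ^ n)"
      using i by (intro prod.remove) auto
    then show ?thesis by (simp add: codebooks_def card_PiE mult.commute)
  qed
  finally show ?thesis .
qed

definition consistent :: "nat \<Rightarrow> (nat \<Rightarrow> 'x) \<Rightarrow> (nat \<Rightarrow> 'x option) \<Rightarrow> bool" where
  "consistent n x y \<longleftrightarrow> (\<forall>j\<in>{1..n}. y j = None \<or> y j = Some (x j))"

text \<open>The rule for ties does not matter: the sent message is always consistent, so every error
  exhibits a rival that agrees with it on the received positions. The default 0 keeps the value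
  below a positive \<open>m\<close>.\<close>

definition consistency_decoder ::
  "nat \<Rightarrow> nat \<Rightarrow> (nat \<Rightarrow> nat \<Rightarrow> 'x) \<Rightarrow> (nat \<Rightarrow> 'x option) \<Rightarrow> nat" where
  "consistency_decoder n m f y =
    (if \<exists>i<m. consistent n (f i) y then LEAST i. i < m \<and> consistent n (f i) y else 0)"

lemma consistency_decoder_less: "0 < m \<Longrightarrow> consistency_decoder n m f y < m"
  using LeastI_ex[of "\<lambda>i. i < m \<and> consistent n (f i) y"] by (auto simp: consistency_decoder_def)

lemma consistency_decoder_error:
  assumes i: "i < m" and err: "consistency_decoder n m f (erase n e (f i)) \<noteq> i"
  obtains i' where "i' < m" "i' \<noteq> i" "\<forall>j\<in>received n e. f i' j = f i j"
proof -
  let ?y = "erase n e (f i)"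
  define d where "d = consistency_decoder n m f ?y"
  have "consistent n (f i) ?y" by (auto simp: consistent_def erase_def)
  then have ex: "\<exists>i<m. consistent n (f i) ?y" using i by blast
  then have "d = (LEAST i. i < m \<and> consistent n (f i) ?y)" by (simp add: d_def consistency_decoder_def)
  then have d: "d < m" "consistent n (f d) ?y"
    using LeastI_ex[OF ex] by auto
  have "\<forall>j\<in>received n e. f d j = f i j"
  proof
    fix j assume "j \<in> received n e"
    then have j: "j \<in> {1..n}" "\<not> e j" by (auto simp: received_def)
    then have "?y j = None \<or> ?y j = Some (f d j)" using d(2) unfolding consistent_def by blast
    then show "f d j = f i j" using j by (simp add: erase_def)
  qed
  with d err show thesis by (intro that[of d]) (auto simp: d_def)
qed

text \<open>Each rival agrees with the sent codeword on the received positions in at most a fraction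
  \<open>|X| ^ (- card (received n e))\<close> of the codebooks, and there are fewer than
  \<open>m\<close> rivals. The bound is the same for every \<open>i\<close>, so it survives
  averaging over messages.\<close>

lemma card_erroneous_codebooks:
  assumes X: "finite X" "X \<noteq> {}" and i: "i < m" and s: "0 \<le> s" "s \<le> 1"
  shows "real (card {f \<in> codebooks X n m. consistency_decoder n m f (erase n e (f i)) \<noteq> i}) \<le>
    real (card (codebooks X n m)) * (real m powr s * (real (card X) powr - s) ^ card (received n e))"
proof -
  let ?R = "received n e" and ?N = "real (card (codebooks X n m))" and ?k = "real (card X)"
  let ?E = "{f \<in> codebooks X n m. consistency_decoder n m f (erase n e (f i)) \<noteq> i}"
  let ?A = "\<lambda>i'. {f \<in> codebooks X n m. \<forall>j\<in>?R. f i' j = f i j}"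
  have k: "0 < ?k" using X by (simp add: card_gt_0_iff)
  define t where "t = real m / ?k ^ card ?R"
  have t: "0 < t" using i k by (simp add: t_def)
  have "?E \<subseteq> (\<Union>i'\<in>{..<m} - {i}. ?A i')"
  proof
    fix f assume f: "f \<in> ?E"
    then have "consistency_decoder n m f (erase n e (f i)) \<noteq> i" by simp
    then obtain i' where "i' < m" "i' \<noteq> i" "\<forall>j\<in>?R. f i' j = f i j"
      using consistency_decoder_error[OF i] by blast
    then show "f \<in> (\<Union>i'\<in>{..<m} - {i}. ?A i')" using f by auto
  qed
  then have "card ?E \<le> card (\<Union>i'\<in>{..<m} - {i}. ?A i')"
    using finite_codebooks[OF X(1)] by (intro card_mono) auto
  also have "\<dots> \<le> (\<Sum>i'\<in>{..<m} - {i}. card (?A i'))" by (intro card_UN_le) auto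
  finally have "real (card ?E) \<le> real (\<Sum>i'\<in>{..<m} - {i}. card (?A i'))" by (rule of_nat_mono)
  also have "\<dots> = (\<Sum>i'\<in>{..<m} - {i}. real (card (?A i')))" by (rule of_nat_sum)
  also have "\<dots> \<le> (\<Sum>i'\<in>{..<m} - {i}. ?N / ?k ^ card ?R)"
  proof (intro sum_mono)
    fix i' assume "i' \<in> {..<m} - {i}"
    then have "i' < m" "i \<noteq> i'" by auto
    then have "card (?A i') * card X ^ card ?R \<le> card (codebooks X n m)"
      by (rule card_agreeing_codebooks[OF X(1) received_subset i])
    then have "real (card (?A i') * card X ^ card ?R) \<le> ?N" by (rule of_nat_mono)
    then have "real (card (?A i')) * ?k ^ card ?R \<le> ?N" by (simp only: of_nat_mult of_nat_power)
    then show "real (card (?A i')) \<le> ?N / ?k ^ card ?R"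
      using k by (simp only: pos_le_divide_eq zero_less_power)
  qed
  also have "\<dots> = real (card ({..<m} - {i})) * (?N / ?k ^ card ?R)" by simp
  also have "\<dots> \<le> real (card {..<m}) * (?N / ?k ^ card ?R)"
    by (intro mult_right_mono of_nat_mono card_mono) auto
  also have "\<dots> = ?N * t" by (simp add: t_def)
  finally have E_t: "real (card ?E) \<le> ?N * t" .
  have E_1: "real (card ?E) \<le> ?N"
    using finite_codebooks[OF X(1)] by (intro of_nat_mono card_mono) auto
  \<comment> \<open>Interpolation between the trivial count, used for \<open>t \<ge> 1\<close>, and
    the union bound, used for \<open>t < 1\<close>, where \<open>t \<le> t powr s\<close>.\<close>
  have "real (card ?E) \<le> ?N * t powr s"
  proof (cases "1 \<le> t")
    case True
    then have "1 \<le> t powr s" using s by (simp add: ge_one_powr_ge_zero)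
    then show ?thesis using E_1 mult_left_mono[of 1 "t powr s" ?N] by linarith
  next
    case False
    then have "t powr 1 \<le> t powr s" using s t by (intro powr_mono') auto
    then have "t \<le> t powr s" using t by simp
    then show ?thesis using E_t mult_left_mono[of t "t powr s" ?N] by linarith
  qed
  also have "t powr s = real m powr s * (?k powr - s) ^ card ?R"
  proof -
    have "(?k ^ card ?R) powr s = ?k powr (real (card ?R) * s)"
      using k by (simp only: powr_realpow[symmetric] powr_powr)
    moreover have "(?k powr - s) ^ card ?R = ?k powr (- s * real (card ?R))"
    proof -
      have "0 < ?k powr - s" using k by simp
      then have "(?k powr - s) ^ card ?R = (?k powr - s) powr real (card ?R)"
        by (rule powr_realpow[symmetric])
      then show ?thesis by (simp only: powr_powr)
    qed
    moreover have "t powr s = real m powr s / (?k ^ card ?R) powr s"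
      unfolding t_def by (rule powr_divide)
    ultimately show ?thesis
      by (simp only: mult_minus_left powr_minus divide_inverse mult.commute)
  qed
  finally show ?thesis .
qed

section \<open>The erasure channel driven by the queue\<close>

text \<open>The range of \<open>p\<close> is demanded at every real argument because sojourn times
  are nonnegative only almost surely; the clamped version of \<open>p\<close> meets the
  demand.\<close>

locale erasure_queue = stationary_queue Q \<tau> S lam F \<pi>
  for Q :: "'w measure" and \<tau> S lam F \<pi> +
  fixes X :: "'x set" and p :: "real \<Rightarrow> real"
  assumes finite_X: "finite X" and X_nonempty: "X \<noteq> {}"
    and p_measurable [measurable]: "p \<in> borel_measurable borel"
    and p_range: "\<And>w. 0 \<le> p w \<and> p w \<le> 1"
begin

abbreviation pattern :: "nat \<Rightarrow> 'w \<Rightarrow> (nat \<Rightarrow> bool) pmf" where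
  "pattern n \<omega> \<equiv> erasure_pattern p n (\<lambda>j. W j \<omega>)"

definition \<beta> :: real where
  "\<beta> = (\<integral>w. 1 - p w \<partial>\<pi>)"

lemma card_X: "1 \<le> card X"
  using finite_X X_nonempty by (simp add: Suc_leI card_gt_0_iff)

lemma survival_range: "0 \<le> 1 - p w \<and> 1 - p w \<le> 1"
  using p_range[of w] by simp

lemma integrable_survival: "integrable Q (\<lambda>\<omega>. 1 - p (W j \<omega>))"
  by (rule integrable_bounded_W(1)[of "\<lambda>w. 1 - p w"]) (use survival_range in auto)

lemma average_survival_L1:
  "(\<lambda>n. expectation (\<lambda>\<omega>. \<bar>(\<Sum>j=1..n. 1 - p (W j \<omega>)) / real n - \<beta>\<bar>)) \<longlonglongrightarrow> 0"
  unfolding \<beta>_def by (rule ergodic_average_L1) (use survival_range in auto)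

lemma integrable_average_survival: "integrable Q (\<lambda>\<omega>. (\<Sum>j=1..n. 1 - p (W j \<omega>)) / real n)"
  by (intro integrable_divide Bochner_Integration.integrable_sum integrable_survival)

lemma mean_survival_tendsto:
  "(\<lambda>n. (\<Sum>j=1..n. expectation (\<lambda>\<omega>. 1 - p (W j \<omega>))) / real n) \<longlonglongrightarrow> \<beta>"
proof (rule LIM_zero_cancel, rule tendsto_rabs_zero_cancel)
  let ?a = "\<lambda>n \<omega>. (\<Sum>j=1..n. 1 - p (W j \<omega>)) / real n"
  show "(\<lambda>n. \<bar>(\<Sum>j=1..n. expectation (\<lambda>\<omega>. 1 - p (W j \<omega>))) / real n - \<beta>\<bar>) \<longlonglongrightarrow> 0"
  proof (rule tendsto_sandwich[OF _ _ tendsto_const average_survival_L1])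
    show "\<forall>\<^sub>F n in sequentially. \<bar>(\<Sum>j=1..n. expectation (\<lambda>\<omega>. 1 - p (W j \<omega>))) / real n - \<beta>\<bar> \<le>
        expectation (\<lambda>\<omega>. \<bar>?a n \<omega> - \<beta>\<bar>)"
    proof (rule always_eventually, rule allI)
      fix n
      have "(\<Sum>j=1..n. expectation (\<lambda>\<omega>. 1 - p (W j \<omega>))) = expectation (\<lambda>\<omega>. \<Sum>j=1..n. 1 - p (W j \<omega>))"
        by (rule Bochner_Integration.integral_sum[symmetric]) (rule integrable_survival)
      then have "(\<Sum>j=1..n. expectation (\<lambda>\<omega>. 1 - p (W j \<omega>))) / real n - \<beta> = expectation (?a n) - \<beta>"
        by (simp only: integral_divide_zero)
      also have "\<dots> = expectation (\<lambda>\<omega>. ?a n \<omega> - \<beta>)"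
        by (subst Bochner_Integration.integral_diff[OF integrable_average_survival]) (simp_all add: prob_space)
      finally show "\<bar>(\<Sum>j=1..n. expectation (\<lambda>\<omega>. 1 - p (W j \<omega>))) / real n - \<beta>\<bar> \<le>
          expectation (\<lambda>\<omega>. \<bar>?a n \<omega> - \<beta>\<bar>)"
        by (simp only: integral_abs_bound)
    qed
  qed auto
qed

lemma pmf_pattern_measurable [measurable]:
  assumes "e \<in> patterns n"
  shows "(\<lambda>\<omega>. pmf (pattern n \<omega>) e) \<in> borel_measurable Q"
proof -
  have "(\<lambda>\<omega>. pmf (pattern n \<omega>) e) = (\<lambda>\<omega>. \<Prod>j\<in>{1..n}. if e j then p (W j \<omega>) else 1 - p (W j \<omega>))"
    by (intro ext pmf_erasure_pattern[OF p_range assms])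
  also have "\<dots> \<in> borel_measurable Q" by (intro borel_measurable_prod) auto
  finally show ?thesis .
qed

lemma integrable_pmf_pattern: "e \<in> patterns n \<Longrightarrow> integrable Q (\<lambda>\<omega>. pmf (pattern n \<omega>) e)"
  by (intro integrable_const_bound[where B=1]) (auto simp: pmf_le_1)

lemma arrival_time_measurable [measurable]: "arrival_time \<tau> j \<in> borel_measurable Q"
  unfolding arrival_time_def[abs_def] by (intro borel_measurable_sum \<tau>_measurable) auto

lemma departure_time_measurable [measurable]: "departure_time \<tau> S j \<in> borel_measurable Q"
proof -
  have "departure_time \<tau> S j = (\<lambda>\<omega>. arrival_time \<tau> j \<omega> + W j \<omega>)" by (simp add: sojourn_time_def)
  then show ?thesis by simp
qed

section \<open>Decoding errors averaged over the queue\<close>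

abbreviation arrivals :: "nat \<Rightarrow> 'w \<Rightarrow> nat \<Rightarrow> real" where
  "arrivals n \<omega> \<equiv> \<lambda>j\<in>{1..n}. arrival_time \<tau> j \<omega>"

abbreviation departures :: "nat \<Rightarrow> 'w \<Rightarrow> nat \<Rightarrow> real" where
  "departures n \<omega> \<equiv> \<lambda>j\<in>{1..n}. departure_time \<tau> S j \<omega>"

lemma decoded_measurable:
  assumes "decoder times_known n m g"
  shows "(\<lambda>\<omega>. g y (arrivals n \<omega>) (departures n \<omega>)) \<in> measurable Q (count_space UNIV)"
proof (cases times_known)
  case True
  let ?P = "(\<Pi>\<^sub>M j\<in>{1..n}. (borel :: real measure))"
  have "(\<lambda>(a, d). g y a d) \<in> measurable (?P \<Otimes>\<^sub>M ?P) (count_space {..<m})"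
    using assms True by (simp add: decoder_def)
  moreover have "(\<lambda>\<omega>. (arrivals n \<omega>, departures n \<omega>)) \<in> measurable Q (?P \<Otimes>\<^sub>M ?P)"
    by (intro measurable_Pair measurable_restrict) auto
  ultimately have "(\<lambda>\<omega>. case (arrivals n \<omega>, departures n \<omega>) of (a, d) \<Rightarrow> g y a d)
      \<in> measurable Q (count_space {..<m})"
    by (rule measurable_compose_rev)
  then show ?thesis
    by (auto intro: measurable_compose[where N="count_space {..<m}" and g="\<lambda>x. x"])
next
  case False
  then obtain h where "\<And>y a d. g y a d = h y" using assms by (auto simp: decoder_def)
  then show ?thesis by simp
qed

abbreviation message_error :: "nat \<Rightarrow> (nat \<Rightarrow> nat \<Rightarrow> 'x) \<Rightarrow>
    ((nat \<Rightarrow> 'x option) \<Rightarrow> (nat \<Rightarrow> real) \<Rightarrow> (nat \<Rightarrow> real) \<Rightarrow> nat) \<Rightarrow> nat \<Rightarrow> 'w \<Rightarrow> real" where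
  "message_error n f g i \<omega> \<equiv> measure_pmf.prob (channel_word p n (f i) (\<lambda>j. W j \<omega>))
     {y. g y (arrivals n \<omega>) (departures n \<omega>) \<noteq> i}"

lemma integrable_message_error:
  assumes "decoder times_known n m g"
  shows "integrable Q (message_error n f g i)"
proof (rule integrable_const_bound[where B=1])
  have "(\<lambda>\<omega>. of_bool (g y (arrivals n \<omega>) (departures n \<omega>) \<noteq> i) :: real) \<in> borel_measurable Q" for y
    by (rule measurable_compose[OF decoded_measurable[OF assms]]) simp
  then show "message_error n f g i \<in> borel_measurable Q"
    unfolding prob_channel_word
    by (intro borel_measurable_sum borel_measurable_times pmf_pattern_measurable)
qed auto

text \<open>For each outcome of the queue the times are frozen, and the decoder becomes a function
  of the output word alone. The bound for fixed sojourn times therefore applies to either kind of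
  receiver, and is then integrated.\<close>

lemma converse_bound:
  assumes f: "encoder X n m f" and g: "decoder times_known n m g"
  shows "log 2 m * (1 - error_probability Q \<tau> S p n m f g) \<le>
    log 2 (card X) * (\<Sum>j=1..n. expectation (\<lambda>\<omega>. 1 - p (W j \<omega>))) + 1"
proof -
  let ?L = "log 2 (real m)" and ?l = "log 2 (real (card X))"
  \<comment> \<open>A decoder has values below \<open>m\<close>, so some message exists.\<close>
  have m: "0 < m" using g unfolding decoder_def by (metis less_nat_zero_code not_gr_zero)
  have sum_int: "integrable Q (\<lambda>\<omega>. \<Sum>j=1..n. 1 - p (W j \<omega>))"
    by (intro Bochner_Integration.integrable_sum integrable_survival)
  have err_int: "integrable Q (\<lambda>\<omega>. \<Sum>i<m. message_error n f g i \<omega>)"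
    by (intro Bochner_Integration.integrable_sum integrable_message_error[OF g])
  have "real m * (?L - ?l * (\<Sum>j=1..n. expectation (\<lambda>\<omega>. 1 - p (W j \<omega>))) - 1) =
      real m * (?L - ?l * expectation (\<lambda>\<omega>. \<Sum>j=1..n. 1 - p (W j \<omega>)) - 1)"
    by (simp only: Bochner_Integration.integral_sum[OF integrable_survival])
  also have "\<dots> = expectation (\<lambda>\<omega>. real m * (?L - ?l * (\<Sum>j=1..n. 1 - p (W j \<omega>)) - 1))"
    using sum_int by (simp add: prob_space)
  also have "\<dots> \<le> expectation (\<lambda>\<omega>. ?L * (\<Sum>i<m. message_error n f g i \<omega>))"
    using sum_int err_int
    by (intro integral_mono sum_error_ge[OF finite_X X_nonempty f m p_range]) auto
  also have "\<dots> = ?L * (\<Sum>i<m. expectation (message_error n f g i))"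
    unfolding integral_mult_right_zero
    by (rule arg_cong, rule Bochner_Integration.integral_sum, rule integrable_message_error[OF g])
  also have "(\<Sum>i<m. expectation (message_error n f g i)) = real m * error_probability Q \<tau> S p n m f g"
    using m by (simp add: error_probability_def)
  finally have "real m * (?L - ?l * (\<Sum>j=1..n. expectation (\<lambda>\<omega>. 1 - p (W j \<omega>))) - 1) \<le>
      real m * (?L * error_probability Q \<tau> S p n m f g)" by (simp only: mult_ac)
  then have "?L - ?l * (\<Sum>j=1..n. expectation (\<lambda>\<omega>. 1 - p (W j \<omega>))) - 1 \<le>
      ?L * error_probability Q \<tau> S p n m f g" using m by simp
  then show ?thesis by (simp only: algebra_simps)
qed

text \<open>Some codebook is at least as good as the average one. The cap at 1 is kept inside the
  expectation because atypical queue outcomes are controlled by their probability alone.\<close>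

lemma random_coding:
  assumes m: "0 < m" and s: "0 \<le> s" "s \<le> 1"
  obtains f g where "encoder X n m f" "decoder times_known n m g"
    "error_probability Q \<tau> S p n m f g \<le>
      expectation (\<lambda>\<omega>. min 1 (real m powr s *
        (\<Prod>j=1..n. p (W j \<omega>) + (1 - p (W j \<omega>)) * real (card X) powr - s)))"
proof -
  let ?CB = "codebooks X n m" and ?\<kappa> = "real (card X) powr - s"
  let ?g = "\<lambda>f y (a :: nat \<Rightarrow> real) (d :: nat \<Rightarrow> real). consistency_decoder n m f y"
  let ?err = "\<lambda>f. error_probability Q \<tau> S p n m f (?g f)"
  define N where "N = real (card ?CB)"
  define P where "P e = expectation (\<lambda>\<omega>. pmf (pattern n \<omega>) e)" for e
  define b where "b e = min 1 (real m powr s * ?\<kappa> ^ card (received n e))" for e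
  define bad where "bad f e i \<longleftrightarrow> consistency_decoder n m f (erase n e (f i)) \<noteq> i"
    for f :: "nat \<Rightarrow> nat \<Rightarrow> 'x" and e i
  define B where "B = expectation (\<lambda>\<omega>. min 1 (real m powr s *
        (\<Prod>j=1..n. p (W j \<omega>) + (1 - p (W j \<omega>)) * ?\<kappa>)))"
  have CB: "finite ?CB" "?CB \<noteq> {}"
    using finite_codebooks[OF finite_X] codebooks_nonempty[OF X_nonempty] by auto
  have N: "0 < N" using CB by (simp add: N_def card_gt_0_iff)
  have P_nonneg: "0 \<le> P e" for e
    unfolding P_def by (intro Bochner_Integration.integral_nonneg) simp
  \<comment> \<open>The decoder ignores the times, so it is admissible for both kinds of
    receiver.\<close>
  have dec: "decoder times_known n m (?g f)" for f
    unfolding decoder_def using consistency_decoder_less[OF m] by auto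
  have err: "?err f = (\<Sum>i<m. \<Sum>e\<in>patterns n. P e * of_bool (bad f e i)) / real m" for f
  proof -
    have "expectation (message_error n f (?g f) i) = (\<Sum>e\<in>patterns n. P e * of_bool (bad f e i))" for i
    proof -
      have "expectation (message_error n f (?g f) i) =
          expectation (\<lambda>\<omega>. \<Sum>e\<in>patterns n. pmf (pattern n \<omega>) e * of_bool (bad f e i))"
        by (simp only: prob_channel_word bad_def)
      also have "\<dots> = (\<Sum>e\<in>patterns n. expectation (\<lambda>\<omega>. pmf (pattern n \<omega>) e * of_bool (bad f e i)))"
        by (intro Bochner_Integration.integral_sum integrable_mult_left integrable_pmf_pattern)
      finally show ?thesis by (simp only: integral_mult_left_zero P_def)
    qed
    then show ?thesis by (simp add: error_probability_def)
  qed
  have count: "(\<Sum>f\<in>?CB. of_bool (bad f e i)) \<le> N * b e" if i: "i < m" for e i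
  proof -
    have "(\<Sum>f\<in>?CB. of_bool (bad f e i)) = real (card {f\<in>?CB. bad f e i})"
      using CB by (simp add: of_bool_def sum.If_cases Int_def)
    moreover have "real (card {f\<in>?CB. bad f e i}) \<le> N"
      unfolding N_def using CB by (intro of_nat_mono card_mono) auto
    moreover have "real (card {f\<in>?CB. bad f e i}) \<le> N * (real m powr s * ?\<kappa> ^ card (received n e))"
      unfolding N_def bad_def by (rule card_erroneous_codebooks[OF finite_X X_nonempty i s])
    ultimately show ?thesis unfolding b_def by (auto simp: min_def)
  qed
  have b_sum: "(\<Sum>e\<in>patterns n. P e * b e) \<le> B"
  proof -
    have "(\<Sum>e\<in>patterns n. P e * b e) = expectation (\<lambda>\<omega>. \<Sum>e\<in>patterns n. pmf (pattern n \<omega>) e * b e)"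
      unfolding P_def
      by (subst Bochner_Integration.integral_sum)
        (auto intro!: integrable_mult_left integrable_pmf_pattern)
    also have "\<dots> \<le> B"
      unfolding B_def
    proof (rule integral_mono)
      show "integrable Q (\<lambda>\<omega>. \<Sum>e\<in>patterns n. pmf (pattern n \<omega>) e * b e)"
        by (intro Bochner_Integration.integrable_sum integrable_mult_left integrable_pmf_pattern)
      have nonneg: "0 \<le> real m powr s * (\<Prod>j=1..n. p (W j \<omega>) + (1 - p (W j \<omega>)) * ?\<kappa>)" for \<omega>
        using p_range by (intro mult_nonneg_nonneg prod_nonneg) auto
      show "integrable Q (\<lambda>\<omega>. min 1 (real m powr s * (\<Prod>j=1..n. p (W j \<omega>) + (1 - p (W j \<omega>)) * ?\<kappa>)))"
        using nonneg by (intro integrable_const_bound[where B=1]) auto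
      fix \<omega>
      \<comment> \<open>Jensen's inequality for the concave function \<open>min 1\<close>, obtained
        by bounding each of its two arguments.\<close>
      have "(\<Sum>e\<in>patterns n. pmf (pattern n \<omega>) e * b e) \<le> (\<Sum>e\<in>patterns n. pmf (pattern n \<omega>) e * 1)"
        by (intro sum_mono mult_left_mono) (auto simp: b_def)
      then have "(\<Sum>e\<in>patterns n. pmf (pattern n \<omega>) e * b e) \<le> 1" by (simp add: sum_pmf_pattern)
      moreover have "(\<Sum>e\<in>patterns n. pmf (pattern n \<omega>) e * b e) \<le>
          (\<Sum>e\<in>patterns n. pmf (pattern n \<omega>) e * (real m powr s * ?\<kappa> ^ card (received n e)))"
        by (intro sum_mono mult_left_mono) (auto simp: b_def)
      moreover have "\<dots> = real m powr s * (\<Sum>e\<in>patterns n. pmf (pattern n \<omega>) e * ?\<kappa> ^ card (received n e))"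
        by (simp only: sum_distrib_left mult.left_commute)
      moreover have "(\<Sum>e\<in>patterns n. pmf (pattern n \<omega>) e * ?\<kappa> ^ card (received n e)) =
          (\<Prod>j=1..n. p (W j \<omega>) + (1 - p (W j \<omega>)) * ?\<kappa>)"
        by (rule expectation_power_received[OF p_range]) simp
      ultimately show "(\<Sum>e\<in>patterns n. pmf (pattern n \<omega>) e * b e) \<le>
          min 1 (real m powr s * (\<Prod>j=1..n. p (W j \<omega>) + (1 - p (W j \<omega>)) * ?\<kappa>))" by simp
    qed
    finally show ?thesis .
  qed
  have "(\<Sum>f\<in>?CB. ?err f) = (\<Sum>f\<in>?CB. \<Sum>i<m. \<Sum>e\<in>patterns n. P e * of_bool (bad f e i)) / real m"
    by (simp only: err sum_divide_distrib)
  also have "(\<Sum>f\<in>?CB. \<Sum>i<m. \<Sum>e\<in>patterns n. P e * of_bool (bad f e i)) =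
      (\<Sum>i<m. \<Sum>e\<in>patterns n. \<Sum>f\<in>?CB. P e * of_bool (bad f e i))"
    by (subst sum.swap, intro sum.cong refl, rule sum.swap)
  also have "\<dots> = (\<Sum>i<m. \<Sum>e\<in>patterns n. P e * (\<Sum>f\<in>?CB. of_bool (bad f e i)))"
    by (simp only: sum_distrib_left)
  also have "\<dots> \<le> (\<Sum>i<m. \<Sum>e\<in>patterns n. P e * (N * b e))"
    using P_nonneg count by (intro sum_mono mult_left_mono) auto
  also have "\<dots> = real m * (N * (\<Sum>e\<in>patterns n. P e * b e))"
    by (simp add: sum_distrib_left mult_ac)
  also have "\<dots> \<le> real m * (N * B)"
    using b_sum N by (intro mult_left_mono) auto
  finally have total: "(\<Sum>f\<in>?CB. ?err f) \<le> N * B" using m by (simp add: divide_right_mono)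
  have "\<exists>f\<in>?CB. ?err f \<le> B"
  proof (rule ccontr)
    assume "\<not> (\<exists>f\<in>?CB. ?err f \<le> B)"
    then have "(\<Sum>f\<in>?CB. B) < (\<Sum>f\<in>?CB. ?err f)"
      using CB by (intro sum_strict_mono) auto
    then show False using total by (simp add: N_def)
  qed
  then obtain f where "f \<in> ?CB" "?err f \<le> B" by blast
  then show thesis using that[OF encoder_codebooks dec] by (simp only: B_def)
qed

lemma \<beta>_range: "0 \<le> \<beta>"
  unfolding \<beta>_def using p_range by (intro Bochner_Integration.integral_nonneg) auto

text \<open>Here \<open>a\<close> is the rate in nats per symbol. Where the fraction of survivals
  exceeds \<open>\<beta>'\<close>, the product decays at rate
  \<open>(1 - \<kappa>) * \<beta>'\<close>, which beats the growth \<open>s * a\<close> of the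
  message factor; the other queue outcomes have vanishing probability.\<close>

lemma random_coding_error_tendsto_0:
  assumes a: "0 < a" and s: "0 \<le> s" "s \<le> 1" and \<beta>': "\<beta>' < \<beta>"
    and rate: "s * a < (1 - real (card X) powr - s) * \<beta>'"
  shows "(\<lambda>n. expectation (\<lambda>\<omega>. min 1 (real (nat \<lceil>exp (a * real n)\<rceil>) powr s *
    (\<Prod>j=1..n. p (W j \<omega>) + (1 - p (W j \<omega>)) * real (card X) powr - s)))) \<longlonglongrightarrow> 0"
proof -
  define \<kappa> where "\<kappa> = real (card X) powr - s"
  have \<kappa>: "0 < \<kappa>" "\<kappa> \<le> 1"
    using card_X s powr_mono[of "- s" 0 "real (card X)"] by (auto simp: \<kappa>_def)
  define c where "c = (1 - \<kappa>) * \<beta>' - s * a"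
  have c: "0 < c" using rate by (simp add: c_def \<kappa>_def)
  define V where "V n \<omega> = (\<Sum>j=1..n. 1 - p (W j \<omega>)) / real n" for n \<omega>
  define v where "v n = expectation (\<lambda>\<omega>. \<bar>V n \<omega> - \<beta>\<bar>)" for n
  define m where "m n = nat \<lceil>exp (a * real n)\<rceil>" for n :: nat
  define \<Phi> where "\<Phi> n \<omega> = min 1 (real (m n) powr s *
    (\<Prod>j=1..n. p (W j \<omega>) + (1 - p (W j \<omega>)) * \<kappa>))" for n \<omega>
  have V_int: "integrable Q (\<lambda>\<omega>. \<bar>V n \<omega> - \<beta>\<bar>)" for n
    using integrable_average_survival[of n] unfolding V_def by auto
  have V_meas [measurable]: "V n \<in> borel_measurable Q" for n
    unfolding V_def by measurable
  have \<Phi>_nonneg: "0 \<le> \<Phi> n \<omega>" for n \<omega>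
    unfolding \<Phi>_def using p_range \<kappa>
    by (intro min.boundedI mult_nonneg_nonneg prod_nonneg) (auto intro: add_nonneg_nonneg)
  have bound: "expectation (\<Phi> n) \<le> v n / (\<beta> - \<beta>') + 2 * exp (- (c * real n))" if n: "1 \<le> n" for n
  proof -
    let ?A = "{\<omega>\<in>space Q. \<bar>V n \<omega> - \<beta>\<bar> \<ge> \<beta> - \<beta>'}"
    have pw: "\<Phi> n \<omega> \<le> indicat_real ?A \<omega> + 2 * exp (- (c * real n))" if \<omega>: "\<omega> \<in> space Q" for \<omega>
    proof (cases "\<omega> \<in> ?A")
      case True
      have "\<Phi> n \<omega> \<le> 1" by (simp add: \<Phi>_def)
      moreover have "0 \<le> 2 * exp (- (c * real n))" by simp
      moreover have "indicat_real ?A \<omega> = 1" using True by simp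
      ultimately show ?thesis by linarith
    next
      case False
      then have "\<beta>' < V n \<omega>" using \<omega> by auto
      then have V: "real n * \<beta>' \<le> (\<Sum>j=1..n. 1 - p (W j \<omega>))"
        using n by (simp add: V_def field_simps)
      have "(\<Prod>j=1..n. p (W j \<omega>) + (1 - p (W j \<omega>)) * \<kappa>) \<le>
          (\<Prod>j=1..n. exp (- ((1 - \<kappa>) * (1 - p (W j \<omega>)))))"
      proof (intro prod_mono conjI)
        fix j
        show "0 \<le> p (W j \<omega>) + (1 - p (W j \<omega>)) * \<kappa>"
          using p_range[of "W j \<omega>"] \<kappa> by (intro add_nonneg_nonneg mult_nonneg_nonneg) auto
        have "p (W j \<omega>) + (1 - p (W j \<omega>)) * \<kappa> = 1 + - ((1 - \<kappa>) * (1 - p (W j \<omega>)))"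
          by (simp add: algebra_simps)
        also have "\<dots> \<le> exp (- ((1 - \<kappa>) * (1 - p (W j \<omega>))))" by (rule exp_ge_add_one_self)
        finally show "p (W j \<omega>) + (1 - p (W j \<omega>)) * \<kappa> \<le> exp (- ((1 - \<kappa>) * (1 - p (W j \<omega>))))" .
      qed
      also have "\<dots> = exp (- ((1 - \<kappa>) * (\<Sum>j=1..n. 1 - p (W j \<omega>))))"
        by (simp only: exp_sum[symmetric] finite_atLeastAtMost sum_negf sum_distrib_left)
      also have "\<dots> \<le> exp (- ((1 - \<kappa>) * (real n * \<beta>')))"
        using mult_left_mono[OF V, of "1 - \<kappa>"] \<kappa> by simp
      finally have prod: "(\<Prod>j=1..n. p (W j \<omega>) + (1 - p (W j \<omega>)) * \<kappa>) \<le> exp (- ((1 - \<kappa>) * (real n * \<beta>')))" .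
      \<comment> \<open>Rounding up costs at most 1, hence a factor 2, which stays at most 2 after
        raising to the power \<open>s\<close>.\<close>
      have m_le: "real (m n) \<le> 2 * exp (a * real n)"
      proof -
        have "1 \<le> exp (a * real n)" using a by simp
        moreover have "real (m n) \<le> exp (a * real n) + 1"
          unfolding m_def by (simp add: of_nat_nat ceiling_correct)
        ultimately show ?thesis by linarith
      qed
      have "real (m n) powr s \<le> (2 * exp (a * real n)) powr s"
        using m_le s by (intro powr_mono2) auto
      also have "\<dots> = 2 powr s * exp (s * (a * real n))"
        by (simp add: powr_mult exp_powr_real mult_ac)
      also have "\<dots> \<le> 2 * exp (s * (a * real n))"
        using powr_mono[of s 1 "2::real"] s by simp
      finally have "real (m n) powr s * (\<Prod>j=1..n. p (W j \<omega>) + (1 - p (W j \<omega>)) * \<kappa>) \<le>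
          2 * exp (s * (a * real n)) * exp (- ((1 - \<kappa>) * (real n * \<beta>')))"
        using prod by (rule mult_mono) (use p_range \<kappa> in \<open>auto intro!: prod_nonneg add_nonneg_nonneg\<close>)
      also have "\<dots> = 2 * exp (- (c * real n))"
        by (simp add: c_def algebra_simps flip: exp_add)
      finally have "\<Phi> n \<omega> \<le> 2 * exp (- (c * real n))" by (simp add: \<Phi>_def)
      moreover have "0 \<le> indicat_real ?A \<omega>" by simp
      ultimately show ?thesis by linarith
    qed
    have A_meas: "?A \<in> events" by measurable
    have "expectation (\<Phi> n) \<le> expectation (\<lambda>\<omega>. indicat_real ?A \<omega> + 2 * exp (- (c * real n)))"
    proof (rule integral_mono)
      show "integrable Q (\<Phi> n)"
        using \<Phi>_nonneg by (intro integrable_const_bound[where B=1]) (auto simp: \<Phi>_def[abs_def])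
    qed (use pw A_meas in \<open>auto simp: emeasure_eq_measure\<close>)
    also have "\<dots> = prob ?A + 2 * exp (- (c * real n))"
      using A_meas by (simp add: prob_space emeasure_eq_measure)
    also have "prob ?A \<le> v n / (\<beta> - \<beta>')"
      unfolding v_def using V_int \<beta>'
      by (intro integral_Markov_inequality_measure[where A="{}"]) auto
    finally show ?thesis by simp
  qed
  have "v \<longlonglongrightarrow> 0" unfolding v_def V_def by (rule average_survival_L1)
  then have "(\<lambda>n. v n / (\<beta> - \<beta>')) \<longlonglongrightarrow> 0" using \<beta>' by (intro tendsto_divide_zero)
  moreover have "(\<lambda>n. 2 * exp (- (c * real n))) \<longlonglongrightarrow> 0"
  proof -
    have "(\<lambda>n. exp (- c) ^ n) \<longlonglongrightarrow> 0" using c by (intro LIMSEQ_power_zero) simp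
    then have "(\<lambda>n. 2 * exp (- c) ^ n) \<longlonglongrightarrow> 0" by (rule tendsto_mult_right_zero)
    then show ?thesis by (simp add: exp_of_nat_mult[symmetric] mult.commute)
  qed
  ultimately have lim: "(\<lambda>n. v n / (\<beta> - \<beta>') + 2 * exp (- (c * real n))) \<longlonglongrightarrow> 0"
    using tendsto_add by fastforce
  have "(\<lambda>n. expectation (\<Phi> n)) \<longlonglongrightarrow> 0"
  proof (rule tendsto_sandwich[OF _ _ tendsto_const lim])
    show "\<forall>\<^sub>F n in sequentially. 0 \<le> expectation (\<Phi> n)"
      using \<Phi>_nonneg by (intro always_eventually allI Bochner_Integration.integral_nonneg)
    show "\<forall>\<^sub>F n in sequentially. expectation (\<Phi> n) \<le> v n / (\<beta> - \<beta>') + 2 * exp (- (c * real n))"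
      using eventually_ge_at_top[of 1] by eventually_elim (rule bound)
  qed
  then show ?thesis by (simp only: \<Phi>_def[abs_def] m_def \<kappa>_def)
qed

section \<open>From block codes to rates per unit time\<close>

lemma expectation_departure_ge: "real n / lam \<le> expectation (departure_time \<tau> S n)"
  using expectation_departure_time[of n] expectation_W_nonneg[of n] by simp

lemma achievable_rate_le:
  assumes "achievable_rate Q \<tau> S X p times_known R"
  shows "R \<le> lam * log 2 (card X) * \<beta>"
proof (rule ccontr)
  let ?C = "lam * log 2 (real (card X)) * \<beta>" and ?l = "log 2 (real (card X))"
  assume "\<not> R \<le> ?C"
  moreover have l: "0 \<le> ?l" using card_X by simp
  ultimately have CR: "0 \<le> ?C" "?C < R" using \<beta>_range lam_pos by auto
  \<comment> \<open>Chosen so that \<open>R * (1 - \<epsilon>)\<close> is the midpoint of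
    \<open>R\<close> and \<open>?C\<close>, still above the limit of \<open>u\<close>.\<close>
  define \<epsilon> where "\<epsilon> = (R - ?C) / (2 * R)"
  have R: "0 < R" using CR by linarith
  have \<epsilon>: "0 < \<epsilon>" "\<epsilon> < 1" using CR R by (auto simp: \<epsilon>_def field_simps)
  \<comment> \<open>The converse bound per unit time; its extra bit contributes
    \<open>lam / n\<close> and disappears for long blocks.\<close>
  define u where "u n = lam * (?l * ((\<Sum>j=1..n. expectation (\<lambda>\<omega>. 1 - p (W j \<omega>))) / real n) + 1 / real n)" for n
  have "u \<longlonglongrightarrow> lam * (?l * \<beta> + 0)"
    unfolding u_def by (intro tendsto_intros mean_survival_tendsto lim_1_over_n)
  then have "u \<longlonglongrightarrow> ?C" by (simp only: add_0_right mult.assoc)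
  moreover have "?C < (R + ?C) / 2"
  proof -
    have "x < (y + x) / 2" if "x < y" for x y :: real using that by simp
    then show ?thesis using CR(2) .
  qed
  ultimately have "\<forall>\<^sub>F n in sequentially. u n < (R + ?C) / 2"
    by (rule order_tendstoD(2))
  then obtain N where N: "\<And>n. n \<ge> N \<Longrightarrow> u n < (R + ?C) / 2" by (auto simp: eventually_sequentially)
  obtain n Rt T where n: "n \<ge> max N 1" and code: "eps_achievable_code Q \<tau> S X p times_known \<epsilon> n Rt T"
    and R_eq: "R = real n * Rt / T"
    using assms \<epsilon> unfolding achievable_rate_def by (metis max.cobounded2)
  obtain m f g where m: "real m = 2 powr (real n * Rt)" and f: "encoder X n m f"
    and g: "decoder times_known n m g" and T: "expectation (departure_time \<tau> S n) < T"
    and err: "error_probability Q \<tau> S p n m f g < \<epsilon>"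
    using code unfolding eps_achievable_code_def by blast
  let ?L = "log 2 (real m)"
  have L: "?L = real n * Rt" by (simp add: m)
  have "0 < real m" by (simp add: m)
  then have L_nonneg: "0 \<le> ?L" by simp
  have nT: "real n / lam < T" using expectation_departure_ge[of n] T by linarith
  have n_pos: "0 < real n" using n by simp
  have T_pos: "0 < T" using nT n_pos lam_pos by (smt (verit) divide_pos_pos)
  have "R * (1 - \<epsilon>) \<le> ?L / (real n / lam) * (1 - \<epsilon>)"
  proof (intro mult_right_mono)
    \<comment> \<open>The time \<open>T\<close> exceeds the mean arrival time of the last symbol;
      shortening it can only raise the rate, as \<open>?L\<close> is nonnegative.\<close>
    show "R \<le> ?L / (real n / lam)"
      unfolding R_eq L[symmetric] using L_nonneg nT n_pos lam_pos T_pos by (intro divide_left_mono) auto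
  qed (use \<epsilon> in simp)
  also have "\<dots> = (?L * (1 - \<epsilon>)) / (real n / lam)" by simp
  also have "\<dots> \<le> (?l * (\<Sum>j=1..n. expectation (\<lambda>\<omega>. 1 - p (W j \<omega>))) + 1) / (real n / lam)"
  proof (rule divide_right_mono)
    have "?L * (1 - \<epsilon>) \<le> ?L * (1 - error_probability Q \<tau> S p n m f g)"
      using L_nonneg err by (intro mult_left_mono) auto
    also have "\<dots> \<le> ?l * (\<Sum>j=1..n. expectation (\<lambda>\<omega>. 1 - p (W j \<omega>))) + 1"
      by (rule converse_bound[OF f g])
    finally show "?L * (1 - \<epsilon>) \<le> ?l * (\<Sum>j=1..n. expectation (\<lambda>\<omega>. 1 - p (W j \<omega>))) + 1" .
  qed (use lam_pos in simp)
  also have "\<dots> = u n" using n_pos by (simp add: u_def field_simps)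
  also have "\<dots> < (R + ?C) / 2" using N n by simp
  also have "\<dots> = R * (1 - \<epsilon>)" using R by (simp add: \<epsilon>_def field_simps)
  finally show False by simp
qed

text \<open>A one-message code never errs. This keeps the supremum from being taken over an empty
  set, in particular when the formula evaluates to 0.\<close>

lemma achievable_rate_0: "achievable_rate Q \<tau> S X p times_known 0"
  unfolding achievable_rate_def
proof (intro allI impI)
  fix \<epsilon> :: real and N :: nat assume \<epsilon>: "0 < \<epsilon> \<and> \<epsilon> < 1" and "1 \<le> N"
  obtain f where f: "f \<in> codebooks X N 1" using codebooks_nonempty[OF X_nonempty] by blast
  let ?g = "\<lambda>(y :: nat \<Rightarrow> 'x option) (a :: nat \<Rightarrow> real) (d :: nat \<Rightarrow> real). 0 :: nat"
  have "eps_achievable_code Q \<tau> S X p times_known \<epsilon> N 0 (expectation (departure_time \<tau> S N) + 1)"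
    unfolding eps_achievable_code_def
  proof (intro exI[of _ 1] exI[of _ f] exI[of _ ?g] conjI)
    show "encoder X N 1 f" by (rule encoder_codebooks[OF f])
    show "decoder times_known N 1 ?g" by (auto simp: decoder_def)
    show "error_probability Q \<tau> S p N 1 f ?g < \<epsilon>" using \<epsilon> by (simp add: error_probability_def)
  qed simp_all
  then show "\<exists>n\<ge>N. \<exists>Rt T. eps_achievable_code Q \<tau> S X p times_known \<epsilon> n Rt T \<and> 0 = real n * Rt / T"
    by (intro exI[of _ N] exI[of _ "0 :: real"] exI conjI) auto
qed

lemma achievable_rate_below:
  assumes R: "0 < R" "R < lam * log 2 (card X) * \<beta>"
  shows "achievable_rate Q \<tau> S X p times_known R"
proof -
  define C where "C = lam * log 2 (real (card X)) * \<beta>"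
  \<comment> \<open>The gap between \<open>R\<close> and \<open>R'\<close> later absorbs the mean
    sojourn time of the last symbol.\<close>
  define R' where "R' = (R + C) / 2"
  have "R < C" unfolding C_def by (rule R(2))
  then have R': "R < R'" "R' < C" "0 < R'" using R(1) by (auto simp: R'_def)
  have l: "0 < log 2 (real (card X))" and \<beta>: "0 < \<beta>"
    using R card_X \<beta>_range lam_pos by (auto simp: zero_less_mult_iff less_le)
  define b where "b = ln (real (card X))"
  have b: "0 < b" using l by (simp add: b_def log_def zero_less_divide_iff)
  \<comment> \<open>The rate \<open>R'\<close> in bits per second, converted to nats per symbol at
    \<open>lam\<close> symbols per second.\<close>
  define a where "a = R' * ln 2 / lam"
  have a: "0 < a" using R' lam_pos by (simp add: a_def)
  have "a < b * \<beta>"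
  proof -
    have "R' * ln 2 < C * ln 2" using R'(2) by simp
    also have "C * ln 2 = b * \<beta> * lam" by (simp add: C_def b_def log_def)
    finally show ?thesis using lam_pos by (simp add: a_def pos_divide_less_eq)
  qed
  \<comment> \<open>The midpoint of \<open>a / b\<close> and \<open>\<beta>\<close>.\<close>
  define \<beta>' where "\<beta>' = (a / b + \<beta>) / 2"
  have \<beta>': "\<beta>' < \<beta>" "a < b * \<beta>'" using \<open>a < b * \<beta>\<close> b by (auto simp: \<beta>'_def field_simps)
  \<comment> \<open>From \<open>1 - exp (- (s * b)) \<ge> s * b / (1 + s * b)\<close>, the rate
    condition follows from \<open>a * (1 + s * b) < b * \<beta>'\<close>; this \<open>s\<close> uses
    at most half of the slack \<open>b * \<beta>' - a\<close>.\<close>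
  define s where "s = min 1 ((b * \<beta>' - a) / (2 * (a * b)))"
  have s: "0 < s" "s \<le> 1" using a b \<beta>' by (auto simp: s_def)
  have rate: "s * a < (1 - real (card X) powr - s) * \<beta>'"
  proof -
    have "s * (a * b) \<le> (b * \<beta>' - a) / 2"
    proof -
      have "s \<le> (b * \<beta>' - a) / (2 * (a * b))" by (simp add: s_def)
      then have "s * (a * b) \<le> (b * \<beta>' - a) / (2 * (a * b)) * (a * b)"
        using a b by (intro mult_right_mono) auto
      then show ?thesis using a b by simp
    qed
    then have key: "a * (1 + s * b) < b * \<beta>'" using \<beta>'(2) by (simp add: algebra_simps)
    have sb: "0 < 1 + s * b" using s b by (simp add: add_pos_pos)
    have "real (card X) powr - s = exp (- (s * b))" using card_X by (simp add: powr_def b_def)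
    also have "\<dots> \<le> 1 / (1 + s * b)"
      using exp_ge_add_one_self[of "s * b"] sb by (simp add: exp_minus inverse_eq_divide frac_le)
    finally have \<kappa>: "s * b / (1 + s * b) \<le> 1 - real (card X) powr - s"
      using sb by (simp add: field_simps)
    have \<beta>'_pos: "0 < \<beta>'" using \<beta>'(2) a b by (smt (verit) zero_less_mult_pos)
    have "s * a < s * (b * \<beta>') / (1 + s * b)"
      using key sb s by (simp add: pos_less_divide_eq mult.assoc)
    also have "\<dots> = s * b / (1 + s * b) * \<beta>'" by simp
    also have "\<dots> \<le> (1 - real (card X) powr - s) * \<beta>'" using \<kappa> \<beta>'_pos by (intro mult_right_mono) auto
    finally show ?thesis .
  qed
  define m where "m n = nat \<lceil>exp (a * real n)\<rceil>" for n :: nat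
  have m_ge: "exp (a * real n) \<le> real (m n)" for n
    unfolding m_def by (simp add: real_nat_ceiling_ge)
  have m_pos: "0 < m n" for n using m_ge[of n] by (metis exp_gt_zero less_le_trans of_nat_0_less_iff)
  have L_ge: "R' * real n / lam \<le> log 2 (real (m n))" for n
  proof -
    have "a * real n \<le> ln (real (m n))" using m_ge[of n] m_pos[of n] by (simp add: ln_ge_iff)
    then have "a * real n / ln 2 \<le> log 2 (real (m n))" by (simp add: log_def divide_right_mono)
    then show ?thesis by (simp add: a_def mult.commute mult.left_commute)
  qed
  show ?thesis
    unfolding achievable_rate_def
  proof (intro allI impI)
    fix \<epsilon> :: real and N :: nat assume \<epsilon>: "0 < \<epsilon> \<and> \<epsilon> < 1" and N: "1 \<le> N"
    have "\<forall>\<^sub>F n in sequentially. expectation (\<lambda>\<omega>. min 1 (real (m n) powr s *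
        (\<Prod>j=1..n. p (W j \<omega>) + (1 - p (W j \<omega>)) * real (card X) powr - s))) < \<epsilon>"
      unfolding m_def using \<epsilon>
      by (intro order_tendstoD(2)[OF random_coding_error_tendsto_0[OF a less_imp_le[OF s(1)] s(2) \<beta>'(1) rate]]) simp
    \<comment> \<open>The threshold makes \<open>n / lam\<close> plus the mean delay smaller than
      \<open>R' * n / (lam * R)\<close>, which is at most the \<open>T\<close> chosen below.\<close>
    moreover have "\<forall>\<^sub>F n in sequentially. expectation (W n) / real n < (R' / R - 1) / lam"
      using R R' lam_pos by (intro order_tendstoD(2)[OF expectation_W_sublinear]) (simp add: field_simps)
    ultimately have "\<forall>\<^sub>F n in sequentially. n \<ge> N \<and>
        expectation (\<lambda>\<omega>. min 1 (real (m n) powr s *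
          (\<Prod>j=1..n. p (W j \<omega>) + (1 - p (W j \<omega>)) * real (card X) powr - s))) < \<epsilon> \<and>
        expectation (W n) / real n < (R' / R - 1) / lam"
      using eventually_ge_at_top[of N] by eventually_elim simp
    then obtain n where n: "n \<ge> N"
      and err: "expectation (\<lambda>\<omega>. min 1 (real (m n) powr s *
          (\<Prod>j=1..n. p (W j \<omega>) + (1 - p (W j \<omega>)) * real (card X) powr - s))) < \<epsilon>"
      and delay: "expectation (W n) / real n < (R' / R - 1) / lam"
      unfolding eventually_sequentially by blast
    have n_pos: "0 < real n" using n N by simp
    define Rt where "Rt = log 2 (real (m n)) / real n"
    \<comment> \<open>Forced by the demand that the rate be exactly \<open>R\<close>; the rounding
      in \<open>m n\<close> is absorbed here.\<close>
    define T where "T = log 2 (real (m n)) / R"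
    have nRt: "real n * Rt = log 2 (real (m n))" using n_pos by (simp add: Rt_def)
    have L_pos: "0 < log 2 (real (m n))"
    proof -
      have "0 < R' * real n / lam" using R' n_pos lam_pos by simp
      then show ?thesis using L_ge[of n] by linarith
    qed
    have "expectation (departure_time \<tau> S n) < T"
    proof -
      have "expectation (W n) < (R' / R - 1) / lam * real n" using delay n_pos by (simp add: pos_divide_less_eq)
      then have "expectation (departure_time \<tau> S n) < real n / lam + (R' / R - 1) / lam * real n"
        by (simp add: expectation_departure_time)
      also have "\<dots> = R' * real n / lam / R" using R lam_pos by (simp add: field_simps)
      also have "\<dots> \<le> T" unfolding T_def using L_ge[of n] R by (intro divide_right_mono) auto
      finally show ?thesis .
    qed
    moreover obtain f g where "encoder X n (m n) f" "decoder times_known n (m n) g"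
      "error_probability Q \<tau> S p n (m n) f g \<le> expectation (\<lambda>\<omega>. min 1 (real (m n) powr s *
          (\<Prod>j=1..n. p (W j \<omega>) + (1 - p (W j \<omega>)) * real (card X) powr - s)))"
      using random_coding[OF m_pos less_imp_le[OF s(1)] s(2)] by blast
    moreover have "real (m n) = 2 powr (real n * Rt)" using m_pos[of n] by (simp add: nRt)
    ultimately have "eps_achievable_code Q \<tau> S X p times_known \<epsilon> n Rt T"
      unfolding eps_achievable_code_def using err by (meson le_less_trans)
    moreover have "R = real n * Rt / T" unfolding nRt T_def using L_pos R by simp
    ultimately show "\<exists>n\<ge>N. \<exists>Rt T. eps_achievable_code Q \<tau> S X p times_known \<epsilon> n Rt T \<and> R = real n * Rt / T"
      using n by blast
  qed
qed

text \<open>Only rates strictly below the value are shown achievable, so the lower bound passes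
  through all smaller extended reals; those at most 0 are covered by rate 0.\<close>

theorem capacity: "queue_channel_capacity Q \<tau> S X p times_known = ereal (lam * log 2 (card X) * \<beta>)"
proof (rule antisym)
  let ?C = "lam * log 2 (real (card X)) * \<beta>"
  show "queue_channel_capacity Q \<tau> S X p times_known \<le> ereal ?C"
    unfolding queue_channel_capacity_def using achievable_rate_le by (intro SUP_least) auto
  show "ereal ?C \<le> queue_channel_capacity Q \<tau> S X p times_known"
  proof (rule dense_le)
    fix x assume x: "x < ereal ?C"
    have "\<exists>R. achievable_rate Q \<tau> S X p times_known R \<and> x \<le> ereal R"
    proof (cases "x \<le> 0")
      case True
      then show ?thesis using achievable_rate_0 by (intro exI[of _ 0]) (simp add: zero_ereal_def)
    next
      case False
      then obtain r where r: "x = ereal r" "0 < r" "r < ?C"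
        using x by (cases x) auto
      then show ?thesis using achievable_rate_below[of r] by (intro exI[of _ r]) auto
    qed
    then show "x \<le> queue_channel_capacity Q \<tau> S X p times_known"
      unfolding queue_channel_capacity_def by (auto intro: SUP_upper2)
  qed
qed

end

lemma queue_channel_capacity_clamp:
  "queue_channel_capacity Q \<tau> S X (\<lambda>w. min 1 (max 0 (p w))) times_known =
    queue_channel_capacity Q \<tau> S X p times_known"
  by (simp add: queue_channel_capacity_def achievable_rate_def eps_achievable_code_def
      error_probability_def channel_word_clamp)

theorem theorem1:
  fixes Q :: "'w measure"
    and \<tau> S :: "nat \<Rightarrow> 'w \<Rightarrow> real"
    and lam :: real
    and F :: "real \<Rightarrow> real"
    and \<pi> :: "real measure"
    and X :: "'x set"
    and p :: "real \<Rightarrow> real"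
    and times_known :: bool
  assumes queue: "mgi1_queue Q \<tau> S lam F"
    and limit: "limiting_distribution Q (sojourn_time \<tau> S) \<pi>"
    and alphabet: "finite X" "X \<noteq> {}"
    and p_measurable: "p \<in> borel_measurable borel"
    and p_range: "\<And>w. 0 \<le> w \<Longrightarrow> 0 \<le> p w \<and> p w \<le> 1"
  shows "queue_channel_capacity Q \<tau> S X p times_known =
    ereal (lam * log 2 (real (card X)) * (\<integral>w. 1 - p w \<partial>\<pi>))"
proof -
  \<comment> \<open>Clamping leaves the channel unchanged, and it leaves the integral unchanged
    because \<open>\<pi>\<close> lives on \<open>[0, \<infinity>)\<close>, where \<open>p\<close> is
    already in range.\<close>
  let ?q = "\<lambda>w. min 1 (max 0 (p w))"
  note p_meas = p_measurable and range = p_range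
  interpret stationary_queue Q \<tau> S lam F \<pi>
    using queue limit by (intro stationary_queue.intro stationary_queue_axioms.intro)
  interpret erasure_queue Q \<tau> S lam F \<pi> X ?q
    using alphabet p_measurable by unfold_locales auto
  have [measurable_cong]: "sets \<pi> = sets borel"
    using real_distribution_\<pi> by (rule real_distribution.events_eq_borel)
  have "(\<integral>w. 1 - ?q w \<partial>\<pi>) = (\<integral>w. 1 - p w \<partial>\<pi>)"
  proof (rule integral_cong_AE)
    show "AE w in \<pi>. 1 - ?q w = 1 - p w"
      using AE_\<pi>_nonneg by eventually_elim (use range in \<open>auto simp: min_def max_def intro: antisym\<close>)
  qed (use p_meas in measurable)
  then show ?thesis
    using capacity[of times_known] by (simp add: queue_channel_capacity_clamp \<beta>_def)
qed

end
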